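(* Let $M,N\ge 0$ be integers, not both zero. Let $Z(u)$ be the formal power series in $u^{-1}$ with coefficients in $\mathrm{Y}(\mathfrak{gl}_{M|N})$ determined by the identities $\sum_{k=1}^{M+N}T_{kj}(u+M-N)\,T'_{ik}(u)=\delta_{ij}Z(u)$ for all $i,j=1,\dots,M+N$, and let $B(u)$ (the quantum Berezinian) be the product $$\Bigl(\sum_{\sigma\in\mathfrak{S}_M}(-1)^{\sigma}\,T_{\sigma(1)1}(u+M-N-1)\,T_{\sigma(2)2}(u+M-N-2)\cdots T_{\sigma(M)M}(u-N)\Bigr)$$ $$\times\Bigl(\sum_{\sigma\in\mathfrak{S}_N}(-1)^{\sigma}\,T'_{M+1,M+\sigma(1)}(u-N)\,T'_{M+2,M+\sigma(2)}(u-N+1)\cdots T'_{M+N,M+\sigma(N)}(u-1)\Bigr),$$ where $(-1)^\sigma$ is the sign of $\sigma$ and the first (respectively second) factor is $1$ if $M=0$ (respectively $N=0$). Then $$B(u+1)=Z(u)\,B(u)$$ as formal power series in $u^{-1}$.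
   Context: All algebras are over $\mathbb{C}$. For $i=1,\dots,M+N$ put $\bar\imath=0$ if $i\le M$ and $\bar\imath=1$ if $i>M$. Tensor products of $\mathbb{Z}_2$-graded algebras use $(X\otimes Y)(X'\otimes Y')=XX'\otimes YY'\,(-1)^{\deg X'\deg Y}$ for homogeneous elements. Square brackets denote the supercommutator $[X,Y]=XY-(-1)^{\deg X\deg Y}YX$. The Yangian $\mathrm{Y}(\mathfrak{gl}_{M|N})$ is the unital associative $\mathbb{Z}_2$-graded algebra with generators $T_{ij}^{(r)}$ ($r\ge 1$, $1\le i,j\le M+N$), $\deg T_{ij}^{(r)}=\bar\imath+\bar\jmath$, and defining relations, for all $i,j,k,l$, $$(u-v)\,[T_{ij}(u),T_{kl}(v)]\,(-1)^{\bar\imath\bar k+\bar\imath\bar l+\bar k\bar l}=T_{kj}(u)T_{il}(v)-T_{kj}(v)T_{il}(u),$$ where $T_{ij}(u)=\delta_{ij}\cdot 1+T_{ij}^{(1)}u^{-1}+T_{ij}^{(2)}u^{-2}+\cdots$ and $u,v$ are formal variables. Let $E_{ij}$ (degree $\bar\imath+\bar\jmath$) be the standard matrix units of $\mathrm{End}\,\mathbb{C}^{M|N}$ and $T(u)=\sum_{i,j}E_{ij}\otimes T_{ij}(u)\in(\mathrm{End}\,\mathbb{C}^{M|N})\otimes\mathrm{Y}(\mathfrak{gl}_{M|N})[[u^{-1}]]$. The series $T'_{ij}(u)$ are defined by $T(u)^{-1}=\sum_{i,j}E_{ij}\otimes T'_{ij}(u)$. Series in shifted variables such as $T_{ij}(u+c)$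 are re-expanded in powers of $u^{-1}$. A series $Z(u)$ satisfying the stated identities exists, is unique, and has leading term $1$ and central coefficients. $\mathfrak{S}_n$ is the symmetric group on $\{1,\dots,n\}$. *)

theory Defs
  imports
    "HOL-Library.Type_Length"
    "HOL-Library.Poly_Mapping"
    "HOL-Combinatorics.Permutations"
    "HOL-Computational_Algebra.Formal_Power_Series"
    Complex_Main
begin

text \<open>
  The free associative algebra over the complex numbers on letters \<open>Gen r i j\<close>, where the letter
  \<open>Gen r i j\<close> stands for the generator \<open>T\<^sub>i\<^sub>j\<^sup>(\<^sup>r\<^sup>)\<close>. Its elements are the finitely supported
  functions from words to complex numbers; the product of \<^theory>\<open>HOL-Library.Poly_Mapping\<close> is the
  convolution product for the additively written monoid of exponents, here the free monoid.
\<close>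

datatype gen = Gen nat nat nat

datatype gen_word = Word (letters: "gen list")

instantiation gen_word :: monoid_add
begin

definition zero_gen_word :: gen_word
  where "0 = Word []"

definition plus_gen_word :: "gen_word \<Rightarrow> gen_word \<Rightarrow> gen_word"
  where "v + w = Word (letters v @ letters w)"

instance
  by standard (simp_all add: zero_gen_word_def plus_gen_word_def)

end

type_synonym gen_algebra = "gen_word \<Rightarrow>\<^sub>0 complex"

definition idx_par :: "nat \<Rightarrow> nat \<Rightarrow> nat"
  where "idx_par M i = (if i \<le> M then 0 else 1)"

fun gen_deg :: "nat \<Rightarrow> gen \<Rightarrow> nat"
  where "gen_deg M (Gen r i j) = idx_par M i + idx_par M j"

definition word_deg :: "nat \<Rightarrow> gen_word \<Rightarrow> nat"
  where "word_deg M w = sum_list (map (gen_deg M) (letters w))"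

definition free_letter :: "nat \<Rightarrow> nat \<Rightarrow> nat \<Rightarrow> gen_algebra"
  where "free_letter r i j = Poly_Mapping.single (Word [Gen r i j]) 1"

text \<open>The coefficient of \<open>T\<^sub>i\<^sub>j(u)\<close> at the power \<open>-r\<close> of \<open>u\<close>, in the free algebra.\<close>

definition free_coeff :: "nat \<Rightarrow> nat \<Rightarrow> nat \<Rightarrow> gen_algebra"
  where "free_coeff r i j =
    (if r = 0 then (if i = j then 1 else 0) else free_letter r i j)"

definition free_supercomm ::
    "nat \<Rightarrow> nat \<Rightarrow> nat \<Rightarrow> nat \<Rightarrow> nat \<Rightarrow> nat \<Rightarrow> nat \<Rightarrow> gen_algebra"
  where "free_supercomm M r i j s k l =
    free_coeff r i j * free_coeff s k l
    - (-1) ^ ((idx_par M i + idx_par M j) * (idx_par M k + idx_par M l))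
      * (free_coeff s k l * free_coeff r i j)"

text \<open>
  Left side minus right side of the defining relation
  \<open>(u - v) [T\<^sub>i\<^sub>j(u), T\<^sub>k\<^sub>l(v)] (-1)\<^sup>\<epsilon> = T\<^sub>k\<^sub>j(u) T\<^sub>i\<^sub>l(v) - T\<^sub>k\<^sub>j(v) T\<^sub>i\<^sub>l(u)\<close>, taken at the
  power \<open>-r\<close> of \<open>u\<close> and the power \<open>-s\<close> of \<open>v\<close>. The remaining coefficients (first power of \<open>u\<close> or
  of \<open>v\<close>) vanish on both sides, because the leading terms of the series are scalars.
\<close>

definition yangian_rel ::
    "nat \<Rightarrow> nat \<Rightarrow> nat \<Rightarrow> nat \<Rightarrow> nat \<Rightarrow> nat \<Rightarrow> nat \<Rightarrow> gen_algebra"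
  where "yangian_rel M r s i j k l =
    (free_supercomm M (Suc r) i j s k l - free_supercomm M r i j (Suc s) k l)
      * (-1) ^ (idx_par M i * idx_par M k + idx_par M i * idx_par M l + idx_par M k * idx_par M l)
    - (free_coeff r k j * free_coeff s i l - free_coeff s k j * free_coeff r i l)"

text \<open>
  The two-sided ideal generated by the defining relations. The letters that are not among the
  generators \<open>T\<^sub>i\<^sub>j\<^sup>(\<^sup>r\<^sup>)\<close>, \<open>r \<ge> 1\<close>, \<open>1 \<le> i, j \<le> M + N\<close>, are put into the ideal as well, so the quotient
  is the algebra presented by the genuine generators only. Closure under complex scalars is the
  case of \<open>mult\<close> where \<open>a\<close> is a scalar.
\<close>

inductive_set yangian_ideal :: "nat \<Rightarrow> nat \<Rightarrow> gen_algebra set" for M N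
  where
    rel: "i \<in> {1..M + N} \<Longrightarrow> j \<in> {1..M + N} \<Longrightarrow> k \<in> {1..M + N} \<Longrightarrow> l \<in> {1..M + N} \<Longrightarrow>
      yangian_rel M r s i j k l \<in> yangian_ideal M N"
  | stray: "r = 0 \<or> i \<notin> {1..M + N} \<or> j \<notin> {1..M + N} \<Longrightarrow>
      free_letter r i j \<in> yangian_ideal M N"
  | zero: "0 \<in> yangian_ideal M N"
  | add: "p \<in> yangian_ideal M N \<Longrightarrow> q \<in> yangian_ideal M N \<Longrightarrow> p + q \<in> yangian_ideal M N"
  | mult: "p \<in> yangian_ideal M N \<Longrightarrow> a * p * b \<in> yangian_ideal M N"

lemma yangian_ideal_mult_left: "p \<in> yangian_ideal M N \<Longrightarrow> a * p \<in> yangian_ideal M N"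
  using yangian_ideal.mult[of p M N a 1] by simp

lemma yangian_ideal_mult_right: "p \<in> yangian_ideal M N \<Longrightarrow> p * b \<in> yangian_ideal M N"
  using yangian_ideal.mult[of p M N 1 b] by simp

lemma yangian_ideal_uminus: "p \<in> yangian_ideal M N \<Longrightarrow> - p \<in> yangian_ideal M N"
  using yangian_ideal_mult_left[of p M N "-1"] by simp

lemma yangian_ideal_diff:
  "p \<in> yangian_ideal M N \<Longrightarrow> q \<in> yangian_ideal M N \<Longrightarrow> p - q \<in> yangian_ideal M N"
  using yangian_ideal.add[of p M N "- q"] yangian_ideal_uminus[of q M N] by simp


text \<open>
  The ideal does not contain 1: it is annihilated by the character of the free algebra that takes
  the coefficient of the empty word (it sends every series \<open>T\<^sub>i\<^sub>j(u)\<close> to \<open>\<delta>\<^sub>i\<^sub>j\<close>).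
\<close>

lemma gen_word_plus_eq_0_iff: "v + w = 0 \<longleftrightarrow> v = 0 \<and> w = (0 :: gen_word)"
  by (cases v; cases w) (simp add: zero_gen_word_def plus_gen_word_def)

lemma single_add_induct [case_names zero add]:
  assumes "P 0" and "\<And>p w c. P p \<Longrightarrow> P (p + Poly_Mapping.single w c)"
  shows "P (p :: 'a \<Rightarrow>\<^sub>0 'b :: comm_monoid_add)"
proof (induction p rule: Poly_Mapping.update_induct)
  case const
  show ?case using assms(1) by simp
next
  case (update f a b)
  have "Poly_Mapping.update a b f = f + Poly_Mapping.single a b"
    using update(1)
    by (intro poly_mapping_eqI)
      (auto simp: lookup_update lookup_add lookup_single in_keys_iff when_def)
  then show ?case using assms(2) update.IH by simp
qed

lemma empty_word_coeff_mult:
  fixes p q :: gen_algebra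
  shows "Poly_Mapping.lookup (p * q) 0 = Poly_Mapping.lookup p 0 * Poly_Mapping.lookup q 0"
proof (induction p rule: single_add_induct)
  case (add p v c)
  have "Poly_Mapping.lookup (Poly_Mapping.single v c * q) 0
      = Poly_Mapping.lookup (Poly_Mapping.single v c) 0 * Poly_Mapping.lookup q 0"
    by (induction q rule: single_add_induct)
      (auto simp: distrib_left mult_single lookup_add lookup_single when_def gen_word_plus_eq_0_iff)
  with add show ?case by (simp add: distrib_right lookup_add)
qed simp

lemma empty_word_coeff_free_coeff:
  "Poly_Mapping.lookup (free_coeff r i j) 0 = (if r = 0 \<and> i = j then 1 else 0)"
  by (simp add: free_coeff_def free_letter_def lookup_single lookup_one zero_gen_word_def)

lemma empty_word_coeff_sign:
  "Poly_Mapping.lookup ((-1) ^ n :: gen_algebra) 0 = (-1) ^ n"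
  by (induction n) (simp_all add: lookup_one)

lemma empty_word_coeff_ideal:
  "p \<in> yangian_ideal M N \<Longrightarrow> Poly_Mapping.lookup p 0 = 0"
proof (induction rule: yangian_ideal.induct)
  case (rel i j k l r s)
  then show ?case
    by (auto simp: yangian_rel_def free_supercomm_def lookup_minus empty_word_coeff_mult
        empty_word_coeff_free_coeff empty_word_coeff_sign simp flip: mult_2)
next
  case (stray r i j)
  then show ?case by (simp add: free_letter_def lookup_single zero_gen_word_def)
qed (simp_all add: lookup_add empty_word_coeff_mult)


text \<open>
  The \<open>\<int>\<^sub>2\<close>-grading, encoded by its grading automorphism: a homogeneous element \<open>X\<close> goes to
  \<open>(-1)\<^bsup>deg X\<^esup> X\<close>.
\<close>

lift_definition free_grading_aut :: "nat \<Rightarrow> gen_algebra \<Rightarrow> gen_algebra"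
  is "\<lambda>M p w. (-1) ^ word_deg M w * p w"
  by (rule rev_finite_subset) auto

lemma word_deg_plus: "word_deg M (v + w) = word_deg M v + word_deg M w"
  by (simp add: word_deg_def plus_gen_word_def)

lemma word_deg_zero: "word_deg M 0 = 0"
  by (simp add: word_deg_def zero_gen_word_def)

lemma free_grading_aut_add: "free_grading_aut M (p + q) = free_grading_aut M p + free_grading_aut M q"
  by (rule poly_mapping_eqI) (simp add: free_grading_aut.rep_eq lookup_add algebra_simps)

lemma free_grading_aut_diff: "free_grading_aut M (p - q) = free_grading_aut M p - free_grading_aut M q"
  by (rule poly_mapping_eqI) (simp add: free_grading_aut.rep_eq lookup_minus algebra_simps)

lemma free_grading_aut_zero: "free_grading_aut M 0 = 0"
  by (rule poly_mapping_eqI) (simp add: free_grading_aut.rep_eq)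

lemma free_grading_aut_single:
  "free_grading_aut M (Poly_Mapping.single w c) = Poly_Mapping.single w ((-1) ^ word_deg M w * c)"
  by (rule poly_mapping_eqI) (simp add: free_grading_aut.rep_eq lookup_single when_def)

lemma free_grading_aut_one: "free_grading_aut M 1 = 1"
  using free_grading_aut_single[of M 0 1] by (simp add: word_deg_zero)

lemma free_grading_aut_mult: "free_grading_aut M (p * q) = free_grading_aut M p * free_grading_aut M q"
proof (induction p rule: single_add_induct)
  case (add p v c)
  have "free_grading_aut M (Poly_Mapping.single v c * q)
      = free_grading_aut M (Poly_Mapping.single v c) * free_grading_aut M q"
    by (induction q rule: single_add_induct)
      (simp_all add: distrib_left mult_single free_grading_aut_add free_grading_aut_single
        free_grading_aut_zero word_deg_plus power_add algebra_simps)
  with add show ?case by (simp add: distrib_right free_grading_aut_add)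
qed (simp add: free_grading_aut_zero)

lemma free_grading_aut_sign: "free_grading_aut M ((-1) ^ n) = (-1) ^ n"
proof (induction n)
  case (Suc n)
  have "free_grading_aut M (-1) = -1"
    using free_grading_aut_diff[of M 0 1] by (simp add: free_grading_aut_zero free_grading_aut_one)
  with Suc show ?case by (simp only: power_Suc free_grading_aut_mult)
qed (simp add: free_grading_aut_one)

lemma single_minus_one: "Poly_Mapping.single w (- 1 :: complex) = - Poly_Mapping.single w 1"
  by (rule poly_mapping_eqI) (simp add: lookup_single when_def)

lemma free_grading_aut_letter:
  "free_grading_aut M (free_letter r i j) = (-1) ^ (idx_par M i + idx_par M j) * free_letter r i j"
  by (auto simp: free_letter_def free_grading_aut_single word_deg_def idx_par_def single_minus_one)

lemma free_grading_aut_coeff: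
  "free_grading_aut M (free_coeff r i j) = (-1) ^ (idx_par M i + idx_par M j) * free_coeff r i j"
  by (auto simp: free_coeff_def free_grading_aut_letter free_grading_aut_one free_grading_aut_zero
      simp flip: mult_2)

lemma free_grading_aut_rel:
  "free_grading_aut M (yangian_rel M r s i j k l)
    = (-1) ^ (idx_par M i + idx_par M j + idx_par M k + idx_par M l) * yangian_rel M r s i j k l"
  by (simp add: yangian_rel_def free_supercomm_def free_grading_aut_diff free_grading_aut_mult
      free_grading_aut_coeff free_grading_aut_sign)
    (auto simp: idx_par_def)

lemma free_grading_aut_ideal:
  "p \<in> yangian_ideal M N \<Longrightarrow> free_grading_aut M p \<in> yangian_ideal M N"
  by (induction rule: yangian_ideal.induct)
    (simp_all add: free_grading_aut_add free_grading_aut_mult free_grading_aut_zero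
      free_grading_aut_rel free_grading_aut_letter yangian_ideal.intros yangian_ideal_mult_left)


text \<open>
  The Yangian of \<open>\<gg>\<ll>\<^bsub>M|N\<^esub>\<close>, where \<open>M\<close> and \<open>N\<close> are the lengths of the two type arguments. The class
  \<^class>\<open>len0\<close> has types of every length, including 0.
\<close>

quotient_type (overloaded) ('m, 'n) yangian =
    gen_algebra / "\<lambda>p q. p - q \<in> yangian_ideal LENGTH('m::len0) LENGTH('n::len0)"
  morphisms rep_yangian abs_yangian
proof (rule equivpI)
  let ?I = "yangian_ideal LENGTH('m) LENGTH('n)"
  show "reflp (\<lambda>p q. p - q \<in> ?I)"
    by (simp add: reflp_def yangian_ideal.zero)
  show "symp (\<lambda>p q. p - q \<in> ?I)"
    by (rule sympI) (use yangian_ideal_uminus in fastforce)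
  show "transp (\<lambda>p q. p - q \<in> ?I)"
    by (rule transpI) (use yangian_ideal.add in fastforce)
qed

instantiation yangian :: (len0, len0) ring_1
begin

lift_definition zero_yangian :: "('a, 'b) yangian" is 0 .

lift_definition one_yangian :: "('a, 'b) yangian" is 1 .

lift_definition plus_yangian :: "('a, 'b) yangian \<Rightarrow> ('a, 'b) yangian \<Rightarrow> ('a, 'b) yangian"
  is "(+)"
  by (simp add: add_diff_add yangian_ideal.add)

lift_definition minus_yangian :: "('a, 'b) yangian \<Rightarrow> ('a, 'b) yangian \<Rightarrow> ('a, 'b) yangian"
  is "(-)"
proof -
  fix p p' q q' :: gen_algebra
  let ?I = "yangian_ideal LENGTH('a) LENGTH('b)"
  assume "p - p' \<in> ?I" "q - q' \<in> ?I"
  then have "(p - p') - (q - q') \<in> ?I"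
    by (rule yangian_ideal_diff)
  then show "p - q - (p' - q') \<in> ?I"
    by (simp add: algebra_simps)
qed

lift_definition uminus_yangian :: "('a, 'b) yangian \<Rightarrow> ('a, 'b) yangian"
  is uminus
  by (metis yangian_ideal_uminus minus_diff_minus)

lift_definition times_yangian :: "('a, 'b) yangian \<Rightarrow> ('a, 'b) yangian \<Rightarrow> ('a, 'b) yangian"
  is "(*)"
proof -
  fix p p' q q' :: gen_algebra
  let ?I = "yangian_ideal LENGTH('a) LENGTH('b)"
  assume "p - p' \<in> ?I" "q - q' \<in> ?I"
  then have "(p - p') * q + p' * (q - q') \<in> ?I"
    by (intro yangian_ideal.add yangian_ideal_mult_left yangian_ideal_mult_right)
  then show "p * q - p' * q' \<in> ?I"
    by (simp add: algebra_simps)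
qed

instance
proof
  show "(0 :: ('a, 'b) yangian) \<noteq> 1"
  proof (transfer, rule notI)
    assume "0 - 1 \<in> yangian_ideal LENGTH('a) LENGTH('b)"
    from empty_word_coeff_ideal[OF this] show False
      by (simp add: lookup_minus lookup_one)
  qed
qed (transfer; simp add: algebra_simps yangian_ideal.zero)+

end

lift_definition grading_aut :: "('m::len0, 'n::len0) yangian \<Rightarrow> ('m, 'n) yangian"
  is "free_grading_aut LENGTH('m)"
  by (metis free_grading_aut_ideal free_grading_aut_diff)

lift_definition T_coeff :: "nat \<Rightarrow> nat \<Rightarrow> nat \<Rightarrow> ('m::len0, 'n::len0) yangian"
  is free_coeff .

lemma T_coeff_0: "T_coeff 0 i j = (if i = j then 1 else 0)"
  by (transfer; simp add: free_coeff_def yangian_ideal.zero)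

lemma T_coeff_relation:
  fixes i j k l r s :: nat
  defines "p \<equiv> idx_par LENGTH('m)"
  defines "t \<equiv> T_coeff :: nat \<Rightarrow> nat \<Rightarrow> nat \<Rightarrow> ('m::len0, 'n::len0) yangian"
  defines "comm \<equiv> \<lambda>r s. t r i j * t s k l
      - (-1) ^ ((p i + p j) * (p k + p l)) * (t s k l * t r i j)"
  assumes "i \<in> {1..LENGTH('m) + LENGTH('n)}" "j \<in> {1..LENGTH('m) + LENGTH('n)}"
    "k \<in> {1..LENGTH('m) + LENGTH('n)}" "l \<in> {1..LENGTH('m) + LENGTH('n)}"
  shows "(comm (Suc r) s - comm r (Suc s)) * (-1) ^ (p i * p k + p i * p l + p k * p l)
    = t r k j * t s i l - t s k j * t r i l"
proof -
  have sign: "abs_yangian ((-1) ^ n) = ((-1) ^ n :: ('m, 'n) yangian)" for n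
    by (induction n)
      (simp_all flip: one_yangian.abs_eq uminus_yangian.abs_eq)
  have t: "t r i j = abs_yangian (free_coeff r i j)" for r i j
    by (simp add: t_def T_coeff.abs_eq)
  have "yangian_rel LENGTH('m) r s i j k l \<in> yangian_ideal LENGTH('m) LENGTH('n)"
    using assms by (intro yangian_ideal.rel)
  then show ?thesis
    by (simp add: comm_def p_def t sign[symmetric] times_yangian.abs_eq minus_yangian.abs_eq
        yangian.abs_eq_iff yangian_rel_def free_supercomm_def)
qed

text \<open>
  A formal power series in the inverse of \<open>u\<close> is an element of the type \<^type>\<open>fps\<close> whose variable
  \<^const>\<open>fps_X\<close> is that inverse.
\<close>

definition T_series :: "nat \<Rightarrow> nat \<Rightarrow> ('m::len0, 'n::len0) yangian fps"
  where "T_series i j = Abs_fps (\<lambda>r. T_coeff r i j)"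

text \<open>
  \<open>arg_shift c f\<close> is \<open>f(u + c)\<close>: the variable \<open>X\<close> (the inverse of \<open>u\<close>) is replaced by the inverse of
  \<open>u + c\<close>, which is \<open>X (1 - c X + c\<^sup>2 X\<^sup>2 - \<dots>)\<close>.
\<close>

definition arg_shift :: "int \<Rightarrow> 'a::ring_1 fps \<Rightarrow> 'a fps"
  where "arg_shift c f = f oo (fps_X * Abs_fps (\<lambda>n. of_int ((- c) ^ n)))"

text \<open>
  A family \<open>A\<close> of series indexed by \<open>1, \<dots>, M + N\<close> stands for the sum of all \<open>E\<^sub>i\<^sub>j \<otimes> A\<^sub>i\<^sub>j(u)\<close>. By the
  sign rule for tensor products,
  \<open>(E\<^sub>i\<^sub>j \<otimes> X) (E\<^sub>j\<^sub>l \<otimes> Y) = E\<^sub>i\<^sub>l \<otimes> X Y (-1)\<^bsup>deg E\<^sub>j\<^sub>l deg X\<^esup>\<close> for homogeneous \<open>X\<close>; the sign is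
  the effect on \<open>X\<close> of the \<open>deg E\<^sub>j\<^sub>l\<close>-th iterate of the grading automorphism.
\<close>

definition super_mat_mult ::
    "(nat \<Rightarrow> nat \<Rightarrow> ('m::len0, 'n::len0) yangian fps) \<Rightarrow> (nat \<Rightarrow> nat \<Rightarrow> ('m, 'n) yangian fps)
      \<Rightarrow> nat \<Rightarrow> nat \<Rightarrow> ('m, 'n) yangian fps"
  where "super_mat_mult A B i l =
    (\<Sum>j = 1..LENGTH('m) + LENGTH('n).
      Abs_fps (\<lambda>r. (grading_aut ^^ (idx_par LENGTH('m) j + idx_par LENGTH('m) l)) (fps_nth (A i j) r))
      * B j l)"

definition super_mat_inverse ::
    "(nat \<Rightarrow> nat \<Rightarrow> ('m::len0, 'n::len0) yangian fps) \<Rightarrow> (nat \<Rightarrow> nat \<Rightarrow> ('m, 'n) yangian fps) \<Rightarrow> bool"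
  where "super_mat_inverse A B \<longleftrightarrow>
    (\<forall>i \<in> {1..LENGTH('m) + LENGTH('n)}. \<forall>j \<in> {1..LENGTH('m) + LENGTH('n)}.
      super_mat_mult A B i j = (if i = j then 1 else 0) \<and>
      super_mat_mult B A i j = (if i = j then 1 else 0))"

text \<open>
  The quantum Berezinian; the argument \<open>T'\<close> is to be the inverse of \<open>T_series\<close> in the sense of
  \<open>super_mat_inverse\<close>. The factors do not commute; the lists give their order.
\<close>

definition berezinian ::
    "(nat \<Rightarrow> nat \<Rightarrow> ('m::len0, 'n::len0) yangian fps) \<Rightarrow> ('m, 'n) yangian fps"
  where "berezinian T' =
    (let M = LENGTH('m); N = LENGTH('n) in
      (\<Sum>\<sigma> | \<sigma> permutes {1..M}.
        of_int (sign \<sigma>) * (\<Prod>k\<leftarrow>[1..<M + 1]. arg_shift (int M - int N - int k) (T_series (\<sigma> k) k)))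
      * (\<Sum>\<sigma> | \<sigma> permutes {1..N}.
        of_int (sign \<sigma>) * (\<Prod>k\<leftarrow>[1..<N + 1]. arg_shift (int k - 1 - int N) (T' (M + k) (M + \<sigma> k)))))"

end

theory Submission
  imports Defs
begin

text \<open>
  One index is eliminated at a time. For an even index \<open>x\<close> put \<open>d(u) = T\<^sub>x\<^sub>x(u)\<close> and replace \<open>T(u)\<close>
  by its Schur complement with respect to \<open>d(u)\<close>. This is the inverse of the corresponding block of
  \<open>T'(u)\<close>, which trivially satisfies the relations for \<open>T'(u)\<close>, so inverting once more shows that the
  Schur complement satisfies the Yangian relations on the remaining indices. The relations also give
  \<open>Z(u) = d(u + P) Z\<^sub>1(u) d(u + P - 1)\<^bsup>-1\<^esup>\<close> with \<open>P = M - N\<close>, where \<open>Z\<^sub>1\<close> belongs to the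
  smaller family, and \<open>B(u) = d(u + P - 1) B\<^sub>1(u)\<close>, because the columns of \<open>T\<close> at successive
  arguments are antisymmetric. Hence the identity for \<open>B\<^sub>1\<close> and \<open>Z\<^sub>1\<close> implies the one for \<open>B\<close>
  and \<open>Z\<close>. Once only odd indices are left, changing all parities amounts to changing the sign of
  \<open>u\<close>, and the same elimination applies, now with \<open>d(u - N) B(u) = B\<^sub>1(u)\<close>.
\<close>

subsection \<open>Shifts of the argument\<close>

text \<open>Two formal variables are awkward over noncommuting coefficients, so a relation in u and
  v is replaced by all its specialisations to u + a and u + b with integers a, b. The factor u - v
  becomes the integer a - b, which can be cancelled when it is nonzero; the lost case a = b is
  recovered from polynomial dependence on the shift. At a - b = \<open>\<epsilon>\<close> the
  scalars on both sides cancel altogether, and this is the origin of the unit steps between the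
  arguments in B(u). Passing to a Schur complement changes T but merely restricts T'. The odd factor
  of B(u), written in entries of T', is therefore literally the same throughout the elimination of
  the even indices. The sums defining Z(u) pair the entries in transposed order, so eliminating an
  index there produces a transposed variant of the Schur complement. Comparing it with the genuine
  one costs a shift by \<open>\<epsilon>\<close>, which is exactly the change of M - N caused by
  removing the index.\<close>

definition shift_var :: "int \<Rightarrow> int fps"
  where "shift_var c = fps_X * Abs_fps (\<lambda>n. (- c) ^ n)"

lemma shift_var_nth: "fps_nth (shift_var c) n = (if n = 0 then 0 else (- c) ^ (n - 1))"
  by (simp add: shift_var_def)

lemma shift_var_nth_0 [simp]: "fps_nth (shift_var c) 0 = 0"
  by (simp add: shift_var_nth)

text \<open>This is 1/(u + c) * (1 + c/u) = 1/u. As \<open>int fps\<close> is an integral domain,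
  identities between such series can be proved by clearing denominators.\<close>

lemma shift_var_mult: "shift_var c * (1 + fps_const c * fps_X) = fps_X"
proof -
  have "Abs_fps (\<lambda>n. (- c) ^ n) * (1 + fps_const c * fps_X) = (1 :: int fps)"
  proof (rule fps_ext)
    fix n
    have "Abs_fps (\<lambda>n. (- c) ^ n) * (1 + fps_const c * fps_X)
        = Abs_fps (\<lambda>n. (- c) ^ n) + fps_const c * (fps_X * Abs_fps (\<lambda>n. (- c) ^ n))"
      by (simp add: algebra_simps)
    then show "fps_nth (Abs_fps (\<lambda>n. (- c) ^ n) * (1 + fps_const c * fps_X)) n = fps_nth (1 :: int fps) n"
      by (cases n) simp_all
  qed
  then show ?thesis by (simp add: shift_var_def mult.assoc)
qed

lemma shift_var_denominator_nonzero: "1 + fps_const c * fps_X \<noteq> (0 :: int fps)"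
proof
  assume "1 + fps_const c * fps_X = (0 :: int fps)"
  then have "fps_nth (1 + fps_const c * fps_X) 0 = (0 :: int)" by simp
  then show False by simp
qed

lemma shift_var_diff:
  "shift_var b - shift_var a = fps_const (a - b) * (shift_var a * shift_var b)"
proof -
  let ?A = "1 + fps_const a * fps_X :: int fps" and ?B = "1 + fps_const b * fps_X :: int fps"
  have "(x - y) * (A * B) = (x * B) * A - (y * A) * B" for x y A B :: "int fps"
    by (simp add: algebra_simps)
  then have "(shift_var b - shift_var a) * (?A * ?B)
      = (shift_var b * ?B) * ?A - (shift_var a * ?A) * ?B" .
  also have "\<dots> = fps_X * ?A - fps_X * ?B"
    by (simp only: shift_var_mult)
  also have "\<dots> = fps_const (a - b) * fps_X * fps_X"
    by (simp add: algebra_simps del: fps_const_mult flip: fps_const_sub)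
  also have "\<dots> = fps_const (a - b) * (shift_var a * ?A) * (shift_var b * ?B)"
    by (simp only: shift_var_mult)
  also have "\<dots> = fps_const (a - b) * (shift_var a * shift_var b) * (?A * ?B)"
    by (simp only: ac_simps)
  finally show ?thesis
    by (simp only: mult_right_cancel no_zero_divisors shift_var_denominator_nonzero not_False_eq_True)
qed

lemma shift_var_0: "shift_var 0 = fps_X"
  using shift_var_mult[of 0] by simp

lemma shift_var_compose: "shift_var a oo shift_var b = shift_var (a + b)"
proof -
  have "(shift_var a oo shift_var b) * (1 + fps_const a * shift_var b) = shift_var b"
    using arg_cong[OF shift_var_mult, of "\<lambda>f. f oo shift_var b"]
    by (simp add: fps_compose_mult_distrib fps_compose_add_distrib fps_const_compose)
  then have "(shift_var a oo shift_var b) * (1 + fps_const a * shift_var b) * (1 + fps_const b * fps_X) = fps_X"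
    by (simp only: shift_var_mult)
  moreover have "(1 + fps_const a * shift_var b) * (1 + fps_const b * fps_X) = 1 + fps_const (a + b) * fps_X"
  proof -
    have "(1 + fps_const a * shift_var b) * (1 + fps_const b * fps_X)
        = 1 + fps_const b * fps_X + fps_const a * (shift_var b * (1 + fps_const b * fps_X))"
      by (simp add: algebra_simps)
    then show ?thesis
      by (simp only: shift_var_mult) (simp add: algebra_simps flip: fps_const_add)
  qed
  ultimately have "(shift_var a oo shift_var b) * (1 + fps_const (a + b) * fps_X)
      = shift_var (a + b) * (1 + fps_const (a + b) * fps_X)"
    by (simp only: shift_var_mult mult.assoc)
  then show ?thesis
    using shift_var_denominator_nonzero mult_right_cancel by blast
qed

lemma shift_var_power_nth_less: "n < r \<Longrightarrow> fps_nth (shift_var c ^ r) n = 0"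
  using startsby_zero_power_prefix[of "shift_var c" r] by simp

text \<open>In the expansion of 1/(u + c)^r each \<open>c\<close> comes with one further power of
  1/u, so the coefficient at \<open>n\<close> is homogeneous of degree \<open>n - r\<close> in
  \<open>c\<close>. This is the source of polynomial dependence on the shift.\<close>

lemma shift_var_power_nth_scale:
  "r \<le> n \<Longrightarrow> fps_nth (shift_var c ^ r) n = c ^ (n - r) * fps_nth (shift_var 1 ^ r) n"
proof (induction r arbitrary: n)
  case 0
  then show ?case by simp
next
  case (Suc r)
  have "fps_nth (shift_var c ^ r) i * fps_nth (shift_var c) (n - i)
      = c ^ (n - Suc r) * (fps_nth (shift_var 1 ^ r) i * fps_nth (shift_var 1) (n - i))"
    if "i \<le> n" for i
  proof (cases "r \<le> i \<and> i < n")
    case True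
    have "n - Suc r = (i - r) + (n - i - 1)" using True by simp
    then have "c ^ (n - Suc r) = c ^ (i - r) * c ^ (n - i - 1)" by (simp only: power_add)
    moreover have "(- c) ^ (n - i - 1) = c ^ (n - i - 1) * (- 1) ^ (n - i - 1)"
      by (simp flip: power_mult_distrib)
    ultimately show ?thesis
      using True Suc.IH[of i] by (simp add: shift_var_nth)
  next
    case False
    then show ?thesis using that
      by (auto simp: shift_var_nth shift_var_power_nth_less not_le)
  qed
  then show ?case
    by (simp only: power_Suc2 fps_mult_nth sum_distrib_left) (rule sum.cong; simp)
qed

lemma shift_var_power_nth_self [simp]: "fps_nth (shift_var c ^ n) n = 1"
proof -
  have "fps_nth (shift_var c ^ n) n = fps_nth (shift_var 0 ^ n) n"
    using shift_var_power_nth_scale[of n n c] shift_var_power_nth_scale[of n n 0] by simp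
  then show ?thesis by (simp add: shift_var_0)
qed

text \<open>The coefficients of powers of 1/(u + c) are integers, hence central in every ring. Their
  arithmetic is done in the commutative ring \<open>int fps\<close> and carried over to noncommuting
  coefficients here.\<close>

lemma of_int_shift_var_power:
  "(fps_X * Abs_fps (\<lambda>n. of_int ((- c) ^ n))) ^ r
    = Abs_fps (\<lambda>n. of_int (fps_nth (shift_var c ^ r) n) :: 'a::ring_1)"
proof (induction r)
  case 0
  show ?case by (rule fps_ext) (simp add: fps_one_nth)
next
  case (Suc r)
  have "fps_X * Abs_fps (\<lambda>n. of_int ((- c) ^ n)) = Abs_fps (\<lambda>n. of_int (fps_nth (shift_var c) n) :: 'a)"
    by (rule fps_ext) (simp add: shift_var_nth)
  with Suc show ?case
    by (intro fps_ext) (simp add: fps_mult_nth)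
qed

lemma of_int_left_commute: "x * (of_int k * y) = of_int k * (x * y)" for x y :: "'a::ring_1"
  by (metis mult.assoc mult_of_int_commute)

section \<open>Laws of the substitution of u + c for u\<close>

lemma arg_shift_nth:
  "fps_nth (arg_shift c f) n = (\<Sum>r\<le>n. fps_nth f r * of_int (fps_nth (shift_var c ^ r) n))"
  by (simp only: arg_shift_def fps_compose_nth of_int_shift_var_power fps_nth_Abs_fps atMost_atLeast0)

lemma arg_shift_nth_bound:
  assumes "n \<le> m"
  shows "fps_nth (arg_shift c f) n = (\<Sum>r\<le>m. fps_nth f r * of_int (fps_nth (shift_var c ^ r) n))"
  unfolding arg_shift_nth using assms
  by (intro sum.mono_neutral_left) (auto simp: shift_var_power_nth_less)

lemma arg_shift_nth_0 [simp]: "fps_nth (arg_shift c f) 0 = fps_nth f 0"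
  by (simp add: arg_shift_nth)

lemma arg_shift_add: "arg_shift c (f + g) = arg_shift c f + arg_shift c g"
  by (rule fps_ext) (simp add: arg_shift_nth distrib_right sum.distrib)

lemma arg_shift_zero [simp]: "arg_shift c 0 = 0"
  by (rule fps_ext) (simp add: arg_shift_nth)

lemma arg_shift_minus: "arg_shift c (- f) = - arg_shift c f"
  by (rule fps_ext) (simp add: arg_shift_nth sum_negf)

lemma arg_shift_diff: "arg_shift c (f - g) = arg_shift c f - arg_shift c g"
  using arg_shift_add[of c f "- g"] by (simp add: arg_shift_minus)

lemma arg_shift_sum: "arg_shift c (sum f A) = (\<Sum>x\<in>A. arg_shift c (f x))"
  by (induction A rule: infinite_finite_induct) (simp_all add: arg_shift_add)

lemma arg_shift_one [simp]: "arg_shift c 1 = 1"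
proof (rule fps_ext)
  fix n
  have "fps_nth (arg_shift c 1) n = (\<Sum>r\<in>{0}. fps_nth 1 r * of_int (fps_nth (shift_var c ^ r) n) :: 'a)"
    unfolding arg_shift_nth by (intro sum.mono_neutral_right) (auto simp: fps_one_nth)
  then show "fps_nth (arg_shift c 1) n = fps_nth (1 :: 'a fps) n"
    by (simp add: fps_one_nth)
qed

lemma arg_shift_mult: "arg_shift c (f * g) = arg_shift c f * arg_shift c g"
proof (rule fps_ext)
  fix n
  let ?k = "\<lambda>r m. of_int (fps_nth (shift_var c ^ r) m) :: 'a"
  have k: "?k (i + j) n = (\<Sum>l\<le>n. ?k i l * ?k j (n - l))" for i j
    by (simp add: power_add fps_mult_nth atMost_atLeast0)
  have "fps_nth (arg_shift c (f * g)) n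
      = (\<Sum>m\<le>n. \<Sum>i\<le>m. fps_nth f i * fps_nth g (m - i) * ?k m n)"
    by (simp add: arg_shift_nth fps_mult_nth sum_distrib_right atMost_atLeast0)
  also have "\<dots> = (\<Sum>(i, j)\<in>{(i, j). i + j \<le> n}. fps_nth f i * fps_nth g j * ?k (i + j) n)"
    by (subst sum.triangle_reindex_eq) simp
  \<comment> \<open>The triangle may be enlarged to a square because 1/(u + c)^(i + j) has no terms
    of order below \<open>i + j\<close>; on the square the sums over \<open>i\<close> and
    \<open>j\<close> separate.\<close>
  also have "\<dots> = (\<Sum>(i, j)\<in>{..n} \<times> {..n}. fps_nth f i * fps_nth g j * ?k (i + j) n)"
  proof (rule sum.mono_neutral_left)
    show "\<forall>x\<in>{..n} \<times> {..n} - {(i, j). i + j \<le> n}.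
        (case x of (i, j) \<Rightarrow> fps_nth f i * fps_nth g j * ?k (i + j) n) = 0"
    proof
      fix x assume "x \<in> {..n} \<times> {..n} - {(i, j). i + j \<le> n}"
      then have "fps_nth (shift_var c ^ (fst x + snd x)) n = 0"
        by (auto intro: shift_var_power_nth_less)
      then show "(case x of (i, j) \<Rightarrow> fps_nth f i * fps_nth g j * ?k (i + j) n) = 0"
        by (simp add: case_prod_beta)
    qed
  qed auto
  also have "\<dots> = (\<Sum>i\<le>n. \<Sum>j\<le>n. \<Sum>l\<le>n. fps_nth f i * fps_nth g j * (?k i l * ?k j (n - l)))"
    unfolding k sum.cartesian_product[symmetric] by (simp add: sum_distrib_left)
  also have "\<dots> = (\<Sum>l\<le>n. \<Sum>i\<le>n. \<Sum>j\<le>n. (fps_nth f i * ?k i l) * (fps_nth g j * ?k j (n - l)))"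
  proof -
    have eq: "fps_nth f i * fps_nth g j * (?k i l * ?k j m) = (fps_nth f i * ?k i l) * (fps_nth g j * ?k j m)"
      for i j l m
      by (simp only: mult.assoc of_int_left_commute[of "fps_nth g j"])
    show ?thesis
      unfolding eq by (subst (2) sum.swap, subst sum.swap, simp)
  qed
  also have "\<dots> = (\<Sum>l\<le>n. fps_nth (arg_shift c f) l * fps_nth (arg_shift c g) (n - l))"
    by (intro sum.cong refl) (simp add: arg_shift_nth_bound[where m = n] sum_product)
  also have "\<dots> = fps_nth (arg_shift c f * arg_shift c g) n"
    by (simp add: fps_mult_nth atMost_atLeast0)
  finally show "fps_nth (arg_shift c (f * g)) n = fps_nth (arg_shift c f * arg_shift c g) n" .
qed

lemma arg_shift_arg_shift [simp]: "arg_shift a (arg_shift b f) = arg_shift (a + b) f"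
proof (rule fps_ext)
  fix n
  have k: "fps_nth (shift_var (b + a) ^ r) n
      = (\<Sum>m\<le>n. fps_nth (shift_var b ^ r) m * fps_nth (shift_var a ^ m) n)" for r
  proof -
    have "shift_var (b + a) ^ r = shift_var b ^ r oo shift_var a"
      by (simp add: fps_compose_power flip: shift_var_compose)
    then show ?thesis by (simp only: fps_compose_nth atMost_atLeast0)
  qed
  have "fps_nth (arg_shift a (arg_shift b f)) n
      = (\<Sum>m\<le>n. \<Sum>r\<le>n. fps_nth f r * of_int (fps_nth (shift_var b ^ r) m * fps_nth (shift_var a ^ m) n))"
    unfolding arg_shift_nth[of a]
    by (intro sum.cong refl) (simp add: arg_shift_nth_bound[where m = n] sum_distrib_right mult.assoc)
  also have "\<dots> = fps_nth (arg_shift (a + b) f) n"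
    by (subst sum.swap) (simp add: arg_shift_nth add.commute[of a] k sum_distrib_left)
  finally show "fps_nth (arg_shift a (arg_shift b f)) n = fps_nth (arg_shift (a + b) f) n" .
qed

lemma arg_shift_0 [simp]: "arg_shift 0 f = f"
proof (rule fps_ext)
  fix n
  have "fps_nth (arg_shift 0 f) n = (\<Sum>r\<in>{n}. fps_nth f r * of_int (fps_nth (shift_var 0 ^ r) n))"
    unfolding arg_shift_nth by (intro sum.mono_neutral_right) (auto simp: shift_var_0 fps_X_power_iff)
  then show "fps_nth (arg_shift 0 f) n = fps_nth f n" by simp
qed

text \<open>Covers the cancellations of nonzero integers made below: differences of shifts in the
  relations, 2 in the determinants, and 1 - 2^(d+1) in the next polynomial argument.\<close>

class torsion_free_ring_1 = ring_1 +
  assumes of_nat_mult_eq_0: "of_nat n * x = 0 \<Longrightarrow> n = 0 \<or> x = 0"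

lemma of_int_mult_eq_0_iff [simp]:
  "of_int k * x = 0 \<longleftrightarrow> k = 0 \<or> x = (0 :: 'a::torsion_free_ring_1)"
proof
  assume "of_int k * x = 0"
  moreover from this have "of_nat (nat \<bar>k\<bar>) * x = 0"
    by (cases "0 \<le> k") (simp_all add: of_nat_nat)
  ultimately show "k = 0 \<or> x = 0"
    using of_nat_mult_eq_0 by fastforce
qed auto

lemma fps_nth_of_int_mult: "fps_nth (of_int k * f) n = of_int k * fps_nth f n"
proof -
  have nat: "fps_nth (of_nat m * f) n = of_nat m * fps_nth f n" for m
    by (induction m) (simp_all add: algebra_simps)
  show ?thesis
    by (cases k rule: int_cases2) (simp_all add: nat)
qed

instance fps :: (torsion_free_ring_1) torsion_free_ring_1
proof
  fix n and x :: "'a fps"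
  assume *: "of_nat n * x = 0"
  have "of_int (int n) * fps_nth x k = 0" for k
    using arg_cong[OF *, of "\<lambda>f. fps_nth f k"] fps_nth_of_int_mult[of "int n" x k] by simp
  then show "n = 0 \<or> x = 0"
    by (auto simp: fps_eq_iff simp del: of_int_of_nat_eq)
qed

text \<open>The degree is lowered: with p the polynomial, p(2c) - 2^(d+1) p(c) has no term of degree
  d + 1, still vanishes at all positive integers, and has constant term (1 - 2^(d+1)) times that of
  p.\<close>

lemma polynomial_vanishing_const:
  fixes w :: "nat \<Rightarrow> 'a::torsion_free_ring_1"
  assumes "\<And>c::int. c > 0 \<Longrightarrow> (\<Sum>k\<le>d. of_int (c ^ k) * w k) = 0"
  shows "w 0 = 0"
  using assms
proof (induction d arbitrary: w)
  case 0
  from 0[of 1] show ?case by simp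
next
  case (Suc d)
  have "of_int (1 - 2 ^ Suc d) * w 0 = 0"
  proof -
    have "(\<Sum>k\<le>d. of_int (c ^ k) * (of_int (2 ^ k - 2 ^ Suc d) * w k)) = 0" if "c > 0" for c :: int
    proof -
      have "(\<Sum>k\<le>d. of_int (c ^ k) * (of_int (2 ^ k - 2 ^ Suc d) * w k))
          = (\<Sum>k\<le>Suc d. of_int (c ^ k) * (of_int (2 ^ k - 2 ^ Suc d) * w k))"
        by simp
      also have "\<dots> = (\<Sum>k\<le>Suc d. of_int ((2 * c) ^ k) * w k)
          - of_int (2 ^ Suc d) * (\<Sum>k\<le>Suc d. of_int (c ^ k) * w k)"
        unfolding sum_distrib_left sum_subtractf[symmetric]
      proof (rule sum.cong)
        fix k
        have "of_int (c ^ k) * (of_int (2 ^ k - 2 ^ Suc d) * w k)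
            = of_int (c ^ k * (2 ^ k - 2 ^ Suc d)) * w k"
          by (simp only: of_int_mult mult.assoc)
        also have "c ^ k * (2 ^ k - 2 ^ Suc d) = (2 * c) ^ k - 2 ^ Suc d * c ^ k"
          by (simp add: algebra_simps)
        finally show "of_int (c ^ k) * (of_int (2 ^ k - 2 ^ Suc d) * w k)
            = of_int ((2 * c) ^ k) * w k - of_int (2 ^ Suc d) * (of_int (c ^ k) * w k)"
          by (simp only: of_int_diff of_int_mult left_diff_distrib mult.assoc)
      qed simp
      also have "\<dots> = 0"
        using Suc.prems[of c] Suc.prems[of "2 * c"] that by simp
      finally show ?thesis .
    qed
    from Suc.IH[OF this] show ?thesis by simp
  qed
  moreover have "(1 - 2 ^ Suc d :: int) \<noteq> 0"
    using one_less_power[of "2 :: int" "Suc d"] by linarith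
  ultimately show ?case
    unfolding of_int_mult_eq_0_iff by blast
qed

text \<open>The coefficients of \<open>g(u + c)\<close> are polynomials in \<open>c\<close>, so an identity that holds for all
  \<open>c > 0\<close> extends to \<open>c = 0\<close>.\<close>

lemma commute_if_commute_shifts:
  fixes f g :: "'a::torsion_free_ring_1 fps"
  assumes comm: "\<And>c. c > 0 \<Longrightarrow> f * arg_shift c g = arg_shift c g * f"
  shows "f * g = g * f"
proof (rule fps_ext)
  fix n
  \<comment> \<open>g(u + c) is the sum of all c^k \<open>D k\<close>, by homogeneity of the
    coefficients in \<open>c\<close>. The commutator of \<open>f\<close> with it is then a
    polynomial in \<open>c\<close> at each order, whose constant term belongs to
    \<open>D 0 = g\<close>.\<close>
  define D where "D k = Abs_fps (\<lambda>m. if k \<le> m then fps_nth g (m - k) *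
    of_int (fps_nth (shift_var 1 ^ (m - k)) m) else 0)" for k
  have D0: "D 0 = g"
    by (rule fps_ext) (simp add: D_def)
  have shift: "fps_nth (arg_shift c g) m = (\<Sum>k\<le>n. of_int (c ^ k) * fps_nth (D k) m)" if "m \<le> n" for m c
  proof -
    have "fps_nth (arg_shift c g) m
        = (\<Sum>k\<le>m. fps_nth g (m - k) * of_int (fps_nth (shift_var c ^ (m - k)) m))"
      unfolding arg_shift_nth
      by (rule sum.reindex_bij_witness[of _ "\<lambda>k. m - k" "\<lambda>k. m - k"]) auto
    also have "\<dots> = (\<Sum>k\<le>m. of_int (c ^ k) * fps_nth (D k) m)"
    proof (rule sum.cong)
      fix k assume "k \<in> {..m}"
      then have "fps_nth (shift_var c ^ (m - k)) m = c ^ k * fps_nth (shift_var 1 ^ (m - k)) m"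
        using shift_var_power_nth_scale[of "m - k" m c] by simp
      then show "fps_nth g (m - k) * of_int (fps_nth (shift_var c ^ (m - k)) m)
          = of_int (c ^ k) * fps_nth (D k) m"
        using \<open>k \<in> {..m}\<close>
        by (simp only: D_def fps_nth_Abs_fps atMost_iff if_True of_int_mult
            of_int_left_commute[of "fps_nth g (m - k)"])
    qed simp
    also have "\<dots> = (\<Sum>k\<le>n. of_int (c ^ k) * fps_nth (D k) m)"
      using that by (intro sum.mono_neutral_left) (auto simp: D_def)
    finally show ?thesis .
  qed
  let ?w = "\<lambda>k. fps_nth (f * D k - D k * f) n"
  have "(\<Sum>k\<le>n. of_int (c ^ k) * ?w k) = 0" if "c > 0" for c
  proof -
    have *: "fps_nth f i * (of_int (c ^ k) * y) = of_int (c ^ k) * (fps_nth f i * y)" for i k y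
      by (rule of_int_left_commute)
    have "fps_nth (f * arg_shift c g) n = (\<Sum>i=0..n. \<Sum>k\<le>n. of_int (c ^ k) * (fps_nth f i * fps_nth (D k) (n - i)))"
      unfolding fps_mult_nth by (intro sum.cong refl) (simp only: shift diff_le_self sum_distrib_left *)
    moreover have "fps_nth (arg_shift c g * f) n = (\<Sum>i=0..n. \<Sum>k\<le>n. of_int (c ^ k) * (fps_nth (D k) i * fps_nth f (n - i)))"
      unfolding fps_mult_nth by (intro sum.cong refl) (simp add: shift sum_distrib_right mult.assoc)
    moreover have "(\<Sum>k\<le>n. of_int (c ^ k) * ?w k)
        = (\<Sum>i=0..n. \<Sum>k\<le>n. of_int (c ^ k) * (fps_nth f i * fps_nth (D k) (n - i)))
        - (\<Sum>i=0..n. \<Sum>k\<le>n. of_int (c ^ k) * (fps_nth (D k) i * fps_nth f (n - i)))"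
      by (simp only: fps_sub_nth fps_mult_nth right_diff_distrib sum_subtractf sum_distrib_left
          sum.swap[of _ "{0..n}" "{..n}"])
    ultimately show ?thesis
      by (simp only: comm[OF that] diff_self)
  qed
  then have "?w 0 = 0" by (rule polynomial_vanishing_const)
  then show "fps_nth (f * g) n = fps_nth (g * f) n"
    by (simp add: D0)
qed

lemma fps_unit_if_nth_0_eq_1:
  assumes "fps_nth f 0 = (1 :: 'a::ring_1)"
  obtains g where "f * g = 1" "g * f = 1"
proof -
  have "fps_left_inverse f 1 * f = 1" "f * fps_right_inverse f 1 = 1"
    using assms by (auto intro: fps_left_inverse fps_right_inverse)
  moreover have "fps_left_inverse f 1 = fps_right_inverse f 1"
    by (rule fps_left_inverse_eq_fps_right_inverse) (simp_all add: assms)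
  ultimately show ?thesis
    using that by simp
qed

subsection \<open>Substitution into two-variable coefficient families\<close>

text \<open>The value of a double series in 1/u and 1/v at u + a and u + b. The bounds on
  \<open>r\<close> and \<open>s\<close> lose nothing, since the omitted terms have order above
  \<open>n\<close>.\<close>

definition double_subst :: "int \<Rightarrow> int \<Rightarrow> (nat \<Rightarrow> nat \<Rightarrow> 'a::ring_1) \<Rightarrow> 'a fps"
  where "double_subst a b c = Abs_fps (\<lambda>n. \<Sum>r\<le>n. \<Sum>s\<le>n.
    c r s * of_int (fps_nth (shift_var a ^ r * shift_var b ^ s) n))"

lemma shift_var_power_mult_nth_less:
  assumes "n < r + s"
  shows "fps_nth (shift_var a ^ r * shift_var b ^ s) n = 0"
  unfolding fps_mult_nth
proof (rule sum.neutral, rule ballI)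
  fix i assume "i \<in> {0..n}"
  with assms have "i < r \<or> n - i < s" by auto
  then show "fps_nth (shift_var a ^ r) i * fps_nth (shift_var b ^ s) (n - i) = 0"
    by (auto simp: shift_var_power_nth_less)
qed

lemma double_subst_nth_bound:
  assumes "n < m"
  shows "fps_nth (double_subst a b c) n = (\<Sum>r<m. \<Sum>s<m.
    c r s * of_int (fps_nth (shift_var a ^ r * shift_var b ^ s) n))"
proof -
  let ?f = "\<lambda>r s. c r s * of_int (fps_nth (shift_var a ^ r * shift_var b ^ s) n)"
  have "(\<Sum>r\<le>n. \<Sum>s\<le>n. ?f r s) = (\<Sum>r\<le>n. \<Sum>s<m. ?f r s)"
    using assms by (intro sum.cong sum.mono_neutral_left) (auto simp: shift_var_power_mult_nth_less)
  also have "\<dots> = (\<Sum>r<m. \<Sum>s<m. ?f r s)"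
    using assms by (intro sum.mono_neutral_left) (auto simp: shift_var_power_mult_nth_less)
  finally show ?thesis by (simp add: double_subst_def)
qed

lemma double_subst_diff:
  "double_subst a b (\<lambda>r s. c r s - d r s) = double_subst a b c - double_subst a b d"
  by (rule fps_ext) (simp add: double_subst_def left_diff_distrib sum_subtractf)

lemma double_subst_uminus: "double_subst a b (\<lambda>r s. - c r s) = - double_subst a b c"
  by (rule fps_ext) (simp add: double_subst_def sum_negf)

lemma double_subst_swap: "double_subst a b (\<lambda>r s. c s r) = double_subst b a c"
  by (rule fps_ext) (simp add: double_subst_def mult.commute, rule sum.swap)

lemma double_subst_prod:
  "double_subst a b (\<lambda>r s. fps_nth f r * fps_nth g s) = arg_shift a f * arg_shift b g"
proof (rule fps_ext)
  fix n
  let ?k = "\<lambda>c r m. of_int (fps_nth (shift_var c ^ r) m) :: 'a"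
  have eq: "fps_nth f i * fps_nth g j * (?k a i l * ?k b j m)
      = (fps_nth f i * ?k a i l) * (fps_nth g j * ?k b j m)" for i j l m
    by (simp only: mult.assoc of_int_left_commute[of "fps_nth g j"])
  have "fps_nth (arg_shift a f * arg_shift b g) n
      = (\<Sum>l\<le>n. \<Sum>r\<le>n. \<Sum>s\<le>n. fps_nth f r * fps_nth g s * (?k a r l * ?k b s (n - l)))"
    unfolding eq fps_mult_nth atMost_atLeast0[symmetric]
    by (intro sum.cong refl) (simp add: arg_shift_nth_bound[where m = n] sum_product)
  also have "\<dots> = (\<Sum>r\<le>n. \<Sum>s\<le>n. \<Sum>l\<le>n. fps_nth f r * fps_nth g s * (?k a r l * ?k b s (n - l)))"
    by (subst sum.swap) (intro sum.cong refl sum.swap)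
  also have "\<dots> = fps_nth (double_subst a b (\<lambda>r s. fps_nth f r * fps_nth g s)) n"
    by (simp add: double_subst_def fps_mult_nth sum_distrib_left atMost_atLeast0)
  finally show "fps_nth (double_subst a b (\<lambda>r s. fps_nth f r * fps_nth g s)) n
      = fps_nth (arg_shift a f * arg_shift b g) n" by simp
qed

text \<open>With \<open>X = 1/(u + a)\<close> and \<open>Y = 1/(u + b)\<close> one has \<open>(a - b) X Y = Y - X\<close>, so that multiplication
  by \<open>a - b\<close> lowers one of the two exponents.\<close>

lemma double_subst_diff_mult:
  assumes c0: "\<And>s. c 0 s = 0" "\<And>r. c r 0 = 0"
  shows "of_int (a - b) * double_subst a b c = double_subst a b (\<lambda>r s. c (Suc r) s - c r (Suc s))"
proof (rule fps_ext)
  fix n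
  define h where "h r s = (of_int (fps_nth (shift_var a ^ r * shift_var b ^ s) n) :: 'a)" for r s
  have h0: "h r s = 0" if "n < r + s" for r s
    using shift_var_power_mult_nth_less[OF that] by (simp add: h_def)
  have hh: "of_int (a - b) * h (Suc r) (Suc s) = h r (Suc s) - h (Suc r) s" for r s
  proof -
    have "fps_const (a - b) * (shift_var a ^ Suc r * shift_var b ^ Suc s)
        = shift_var a ^ r * shift_var b ^ s * (fps_const (a - b) * (shift_var a * shift_var b))"
      by (simp only: power_Suc ac_simps)
    also have "\<dots> = shift_var a ^ r * shift_var b ^ Suc s - shift_var a ^ Suc r * shift_var b ^ s"
      unfolding shift_var_diff[symmetric] by (simp only: right_diff_distrib power_Suc ac_simps)
    finally have "(a - b) * fps_nth (shift_var a ^ Suc r * shift_var b ^ Suc s) n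
        = fps_nth (shift_var a ^ r * shift_var b ^ Suc s) n - fps_nth (shift_var a ^ Suc r * shift_var b ^ s) n"
      by (metis fps_mult_left_const_nth fps_sub_nth)
    then show ?thesis
      unfolding h_def by (metis of_int_diff of_int_mult)
  qed
  \<comment> \<open>The sums start one index beyond what order \<open>n\<close> requires: removing
    the vanishing row and column then leaves a full range, and the terms added or dropped at the top
    are zero by \<open>h0\<close>.\<close>
  let ?m = "Suc n"
  have "fps_nth (of_int (a - b) * double_subst a b c) n
      = (\<Sum>r<Suc ?m. \<Sum>s<Suc ?m. c r s * (of_int (a - b) * h r s))"
    unfolding fps_nth_of_int_mult double_subst_nth_bound[OF less_SucI[OF lessI]] h_def
    by (simp only: sum_distrib_left of_int_left_commute[symmetric])
  also have "\<dots> = (\<Sum>r<?m. \<Sum>s<?m. c (Suc r) (Suc s) * (of_int (a - b) * h (Suc r) (Suc s)))"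
    unfolding sum.lessThan_Suc_shift[of _ ?m] by (simp only: c0) simp
  also have "\<dots> = (\<Sum>r<?m. \<Sum>s<?m. c (Suc r) (Suc s) * h r (Suc s))
      - (\<Sum>r<?m. \<Sum>s<?m. c (Suc r) (Suc s) * h (Suc r) s)"
    by (simp only: hh right_diff_distrib sum_subtractf)
  also have "(\<Sum>r<?m. \<Sum>s<?m. c (Suc r) (Suc s) * h r (Suc s)) = (\<Sum>r<?m. \<Sum>s<Suc ?m. c (Suc r) s * h r s)"
    unfolding sum.lessThan_Suc_shift[of _ ?m] by (simp only: c0) simp
  also have "\<dots> = (\<Sum>r<?m. \<Sum>s<?m. c (Suc r) s * h r s)"
    by (simp add: h0)
  also have "(\<Sum>r<?m. \<Sum>s<?m. c (Suc r) (Suc s) * h (Suc r) s) = (\<Sum>r<Suc ?m. \<Sum>s<?m. c r (Suc s) * h r s)"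
    unfolding sum.lessThan_Suc_shift[of _ ?m] by (simp only: c0) simp
  also have "\<dots> = (\<Sum>r<?m. \<Sum>s<?m. c r (Suc s) * h r s)"
    by (simp add: h0)
  also have "(\<Sum>r<?m. \<Sum>s<?m. c (Suc r) s * h r s) - (\<Sum>r<?m. \<Sum>s<?m. c r (Suc s) * h r s)
      = fps_nth (double_subst a b (\<lambda>r s. c (Suc r) s - c r (Suc s))) n"
    by (simp only: double_subst_nth_bound[of n ?m, OF lessI] left_diff_distrib sum_subtractf h_def)
  finally show "fps_nth (of_int (a - b) * double_subst a b c) n
      = fps_nth (double_subst a b (\<lambda>r s. c (Suc r) s - c r (Suc s))) n" .
qed

text \<open>Parities are truth values, so that inequality is addition modulo 2 and conjunction is
  multiplication. Comparing signs becomes propositional reasoning.\<close>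

definition signed :: "bool \<Rightarrow> 'a \<Rightarrow> 'a::ab_group_add"
  where "signed b x = (if b then - x else x)"

lemma signed_True [simp]: "signed True x = - x"
  and signed_False [simp]: "signed False x = x"
  and signed_zero [simp]: "signed b 0 = 0"
  and signed_signed [simp]: "signed b (signed c x) = signed (b \<noteq> c) x"
  by (simp_all add: signed_def)

lemma signed_diff: "signed b (x - y) = signed b x - signed b y"
  by (simp add: signed_def)

lemma signed_sum: "signed b (sum f A) = (\<Sum>x\<in>A. signed b (f x))"
  by (simp add: signed_def sum_negf)

lemma signed_mult: "signed b x * y = signed b (x * y)" "x * signed b y = signed b (x * y)"
  for x y :: "'a::ring"
  by (simp_all add: signed_def)

lemma fps_nth_signed: "fps_nth (signed b f) n = signed b (fps_nth f n)"
  by (simp add: signed_def)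

subsection \<open>RTT relations and inverse matrices\<close>

text \<open>For \<open>\<epsilon> = 1\<close> these are the Yangian relations in terms of \<open>t\<^sub>i\<^sub>j(u) = (-1)\<^bsup>j(i+1)\<^esup> T\<^sub>i\<^sub>j(u)\<close> (exponents
  are parities). With these signs the product of graded matrices becomes the ordinary matrix
  product. The inverse matrix satisfies the relations with \<open>\<epsilon> = -1\<close>.\<close>

definition rtt :: "int \<Rightarrow> (nat \<Rightarrow> bool) \<Rightarrow> nat set \<Rightarrow> (nat \<Rightarrow> nat \<Rightarrow> 'a::ring_1 fps) \<Rightarrow> bool"
  where "rtt \<epsilon> p I t \<longleftrightarrow> (\<forall>i\<in>I. \<forall>j\<in>I. \<forall>k\<in>I. \<forall>l\<in>I. \<forall>a b.
    of_int (a - b) * (arg_shift a (t i j) * arg_shift b (t k l)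
      - signed (p i \<noteq> p j \<and> p k \<noteq> p l) (arg_shift b (t k l) * arg_shift a (t i j)))
    = of_int \<epsilon> * signed ((p i \<and> p j) \<noteq> ((p j \<and> p k) \<noteq> (p i \<and> p k)))
      (arg_shift a (t k j) * arg_shift b (t i l) - arg_shift b (t k j) * arg_shift a (t i l)))"

definition inverse_on :: "nat set \<Rightarrow> (nat \<Rightarrow> nat \<Rightarrow> 'a::ring_1) \<Rightarrow> (nat \<Rightarrow> nat \<Rightarrow> 'a) \<Rightarrow> bool"
  where "inverse_on I t y \<longleftrightarrow> finite I \<and> (\<forall>i\<in>I. \<forall>j\<in>I.
    (\<Sum>k\<in>I. t i k * y k j) = (if i = j then 1 else 0) \<and>
    (\<Sum>k\<in>I. y i k * t k j) = (if i = j then 1 else 0))"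

lemma inverse_on_sym: "inverse_on I t y \<Longrightarrow> inverse_on I y t"
  by (auto simp: inverse_on_def)

lemma inverse_on_finite: "inverse_on I t y \<Longrightarrow> finite I"
  by (simp add: inverse_on_def)

lemma inverse_on_mult:
  assumes "inverse_on I t y" "i \<in> I" "j \<in> I"
  shows "(\<Sum>k\<in>I. t i k * y k j) = (if i = j then 1 else 0)"
    and "(\<Sum>k\<in>I. y i k * t k j) = (if i = j then 1 else 0)"
    and "(\<Sum>k\<in>I. x * t i k * y k j) = (if i = j then x else 0)"
    and "(\<Sum>k\<in>I. x * y i k * t k j) = (if i = j then x else 0)"
    and "(\<Sum>k\<in>I. t i k * (y k j * x)) = (if i = j then x else 0)"
    and "(\<Sum>k\<in>I. y i k * (t k j * x)) = (if i = j then x else 0)"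
  using assms
  by (simp_all add: inverse_on_def mult.assoc flip: sum_distrib_left)
     (simp_all add: inverse_on_def flip: sum_distrib_right mult.assoc)

lemma inverse_on_arg_shift:
  assumes "inverse_on I t y"
  shows "inverse_on I (\<lambda>i j. arg_shift a (t i j)) (\<lambda>i j. arg_shift a (y i j))"
proof -
  have "(\<Sum>k\<in>I. arg_shift a (t i k) * arg_shift a (y k j)) = (if i = j then 1 else 0) \<and>
      (\<Sum>k\<in>I. arg_shift a (y i k) * arg_shift a (t k j)) = (if i = j then 1 else 0)"
    if "i \<in> I" "j \<in> I" for i j
    using inverse_on_mult(1,2)[OF assms that]
    by (simp flip: arg_shift_mult arg_shift_sum)
  with assms show ?thesis by (simp add: inverse_on_def)
qed

text \<open>The relation between t(u + a) and t(u + b) is multiplied by entries of the inverse at u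
  + b on both sides and summed. It is halfway to \<open>rtt_inverse\<close> and also governs how a
  pivot meets entries of the inverse.\<close>

lemma rtt_cross:
  fixes t y :: "nat \<Rightarrow> nat \<Rightarrow> 'a::ring_1 fps"
  assumes rtt: "rtt \<epsilon> p I t" and inv: "inverse_on I t y"
    and I: "i \<in> I" "j \<in> I" "n \<in> I" "m \<in> I"
  shows "of_int (a - b) * (signed (p i \<noteq> p j \<and> p m) (arg_shift b (y n m) * arg_shift a (t i j))
      - signed (p i \<noteq> p j \<and> p n) (arg_shift a (t i j) * arg_shift b (y n m)))
    = of_int \<epsilon> * signed (p i \<and> p j)
      ((if i = m then \<Sum>k\<in>I. arg_shift b (y n k) * arg_shift a (t k j) else 0)
      - (if n = j then \<Sum>l\<in>I. arg_shift a (t i l) * arg_shift b (y l m) else 0))"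
proof -
  define q where "q \<longleftrightarrow> p i \<noteq> p j"
  define x where "x = (arg_shift a :: 'a fps \<Rightarrow> 'a fps)"
  define A where "A k l = arg_shift b (t k l)" for k l
  define Y where "Y k l = arg_shift b (y k l)" for k l
  define D where "D = (of_int (a - b) :: 'a fps)"
  define E where "E = (of_int \<epsilon> :: 'a fps)"
  have fin: "finite I" using inv by (rule inverse_on_finite)
  have AY: "inverse_on I A Y"
    using inverse_on_arg_shift[OF inv, of b] by (simp add: A_def[abs_def] Y_def[abs_def])
  note collapse = inverse_on_mult[OF AY]
  have D: "z * (D * w) = D * (z * w)" and E: "z * (E * w) = E * (z * w)" for z w
    by (simp_all only: D_def E_def of_int_left_commute)
  have rel: "D * (x (t i j) * A k l - signed (q \<and> p k \<noteq> p l) (A k l * x (t i j)))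
      = E * signed ((p i \<and> p j) \<noteq> ((p j \<and> p k) \<noteq> (p i \<and> p k)))
          (x (t k j) * A i l - A k j * x (t i l))" if "k \<in> I" "l \<in> I" for k l
    using rtt I that unfolding rtt_def D_def E_def A_def x_def q_def by blast
  \<comment> \<open>The sign \<open>q \<and> p k\<close> is chosen so that in each of the four
    resulting products the sign does not depend on the index over which \<open>Y\<close> and
    \<open>A\<close> collapse.\<close>
  have sum: "(\<Sum>k\<in>I. \<Sum>l\<in>I. signed (q \<and> p k) (Y n k * (D * (x (t i j) * A k l - signed (q \<and> p k \<noteq> p l) (A k l * x (t i j))) * Y l m)))
    = (\<Sum>k\<in>I. \<Sum>l\<in>I. signed (q \<and> p k) (Y n k * (E * signed ((p i \<and> p j) \<noteq> ((p j \<and> p k) \<noteq> (p i \<and> p k)))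
          (x (t k j) * A i l - A k j * x (t i l)) * Y l m)))"
    by (intro sum.cong refl) (simp only: rel)
  have L1: "(\<Sum>k\<in>I. \<Sum>l\<in>I. signed (q \<and> p k) (Y n k * x (t i j) * A k l * Y l m))
      = signed (q \<and> p m) (Y n m * x (t i j))"
    using I fin by (simp add: signed_sum[symmetric] collapse if_distrib[of "signed _"] cong: sum.cong if_cong)
  have L2: "(\<Sum>k\<in>I. \<Sum>l\<in>I. signed (q \<and> p l) (Y n k * (A k l * (x (t i j) * Y l m))))
      = signed (q \<and> p n) (x (t i j) * Y n m)"
    using I fin by (subst sum.swap) (simp add: signed_sum[symmetric] collapse if_distrib[of "signed _"] cong: sum.cong if_cong)
  have R1: "(\<Sum>k\<in>I. \<Sum>l\<in>I. Y n k * x (t k j) * A i l * Y l m)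
      = (if i = m then \<Sum>k\<in>I. Y n k * x (t k j) else 0)"
    using I by (simp add: collapse cong: sum.cong)
  have R2: "(\<Sum>k\<in>I. \<Sum>l\<in>I. Y n k * (A k j * (x (t i l) * Y l m)))
      = (if n = j then \<Sum>l\<in>I. x (t i l) * Y l m else 0)"
    using I by (subst sum.swap) (simp add: collapse cong: sum.cong)
  have "(\<Sum>k\<in>I. \<Sum>l\<in>I. signed (q \<and> p k) (Y n k * (D * (x (t i j) * A k l - signed (q \<and> p k \<noteq> p l) (A k l * x (t i j))) * Y l m)))
    = D * (\<Sum>k\<in>I. \<Sum>l\<in>I. signed (q \<and> p k) (Y n k * x (t i j) * A k l * Y l m)
        - signed (q \<and> p l) (Y n k * (A k l * (x (t i j) * Y l m))))"
    unfolding sum_distrib_left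
  proof (intro sum.cong refl)
    fix k l
    have s: "(q \<and> p k) \<noteq> (q \<and> p k \<noteq> p l) \<longleftrightarrow> q \<and> p l" by blast
    show "signed (q \<and> p k) (Y n k * (D * (x (t i j) * A k l - signed (q \<and> p k \<noteq> p l) (A k l * x (t i j))) * Y l m))
      = D * (signed (q \<and> p k) (Y n k * x (t i j) * A k l * Y l m)
        - signed (q \<and> p l) (Y n k * (A k l * (x (t i j) * Y l m))))"
      by (simp only: mult.assoc D left_diff_distrib right_diff_distrib signed_mult signed_diff signed_signed s)
  qed
  also have "\<dots> = D * (signed (q \<and> p m) (Y n m * x (t i j)) - signed (q \<and> p n) (x (t i j) * Y n m))"
    by (simp only: sum_subtractf L1 L2)
  finally have lhs: "(\<Sum>k\<in>I. \<Sum>l\<in>I. signed (q \<and> p k) (Y n k * (D * (x (t i j) * A k l - signed (q \<and> p k \<noteq> p l) (A k l * x (t i j))) * Y l m)))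
    = D * (signed (q \<and> p m) (Y n m * x (t i j)) - signed (q \<and> p n) (x (t i j) * Y n m))" .
  have "(\<Sum>k\<in>I. \<Sum>l\<in>I. signed (q \<and> p k) (Y n k * (E * signed ((p i \<and> p j) \<noteq> ((p j \<and> p k) \<noteq> (p i \<and> p k)))
          (x (t k j) * A i l - A k j * x (t i l)) * Y l m)))
    = E * signed (p i \<and> p j) (\<Sum>k\<in>I. \<Sum>l\<in>I. Y n k * x (t k j) * A i l * Y l m
        - Y n k * (A k j * (x (t i l) * Y l m)))"
    unfolding sum_distrib_left signed_sum
  proof (intro sum.cong refl)
    fix k l
    have s: "(q \<and> p k) \<noteq> ((p i \<and> p j) \<noteq> ((p j \<and> p k) \<noteq> (p i \<and> p k))) \<longleftrightarrow> p i \<and> p j"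
      by (auto simp: q_def)
    show "signed (q \<and> p k) (Y n k * (E * signed ((p i \<and> p j) \<noteq> ((p j \<and> p k) \<noteq> (p i \<and> p k)))
          (x (t k j) * A i l - A k j * x (t i l)) * Y l m))
      = E * signed (p i \<and> p j) (Y n k * x (t k j) * A i l * Y l m
        - Y n k * (A k j * (x (t i l) * Y l m)))"
      by (simp only: mult.assoc E left_diff_distrib right_diff_distrib signed_mult signed_diff signed_signed s)
  qed
  also have "\<dots> = E * signed (p i \<and> p j) ((if i = m then \<Sum>k\<in>I. Y n k * x (t k j) else 0)
      - (if n = j then \<Sum>l\<in>I. x (t i l) * Y l m else 0))"
    by (simp only: sum_subtractf R1 R2)
  finally have rhs: "(\<Sum>k\<in>I. \<Sum>l\<in>I. signed (q \<and> p k) (Y n k * (E * signed ((p i \<and> p j) \<noteq> ((p j \<and> p k) \<noteq> (p i \<and> p k)))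
          (x (t k j) * A i l - A k j * x (t i l)) * Y l m)))
    = E * signed (p i \<and> p j) ((if i = m then \<Sum>k\<in>I. Y n k * x (t k j) else 0)
      - (if n = j then \<Sum>l\<in>I. x (t i l) * Y l m else 0))" .
  show ?thesis
    using sum unfolding lhs rhs unfolding D_def E_def Y_def x_def q_def by simp
qed

text \<open>In \<open>rtt_cross\<close> one of the two factors is already inverted; multiplying by
  entries of the inverse at the other argument on both sides inverts the second one too.\<close>

lemma rtt_inverse:
  fixes t y :: "nat \<Rightarrow> nat \<Rightarrow> 'a::ring_1 fps"
  assumes rtt: "rtt \<epsilon> p I t" and inv: "inverse_on I t y"
  shows "rtt (- \<epsilon>) p I y"
proof -
  have fin: "finite I" using inv by (rule inverse_on_finite)
  have main: "of_int (a - b) * (signed (p r \<and> p m \<noteq> p n) (arg_shift a (y q r) * arg_shift b (y n m))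
      - signed (p q \<and> p m \<noteq> p n) (arg_shift b (y n m) * arg_shift a (y q r)))
    = of_int \<epsilon> * signed (p n \<and> p m)
      (arg_shift a (y q m) * arg_shift b (y n r) - arg_shift b (y q m) * arg_shift a (y n r))"
    if I: "q \<in> I" "r \<in> I" "n \<in> I" "m \<in> I" for q r n m a b
  proof -
    define x where "x i j = arg_shift a (t i j)" for i j
    define X where "X i j = arg_shift a (y i j)" for i j
    define Y where "Y i j = arg_shift b (y i j)" for i j
    define D where "D = (of_int (a - b) :: 'a fps)"
    define E where "E = (of_int \<epsilon> :: 'a fps)"
    have xX: "inverse_on I x X"
      using inverse_on_arg_shift[OF inv, of a] by (simp add: x_def[abs_def] X_def[abs_def])
    note collapse = inverse_on_mult[OF xX]
    have D: "z * (D * w) = D * (z * w)" and E: "z * (E * w) = E * (z * w)" for z w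
      by (simp_all only: D_def E_def of_int_left_commute)
    \<comment> \<open>Again the sign that frees every product from dependence on the collapsing
      index, now that of \<open>x\<close> and \<open>X\<close>.\<close>
    let ?s = "\<lambda>i j. (p n \<and> p i) \<noteq> (p m \<and> p j)"
    let ?L = "\<lambda>i j. D * (signed (p i \<noteq> p j \<and> p m) (Y n m * x i j) - signed (p i \<noteq> p j \<and> p n) (x i j * Y n m))"
    let ?R = "\<lambda>i j. E * signed (p i \<and> p j) ((if i = m then \<Sum>k\<in>I. Y n k * x k j else 0)
      - (if n = j then \<Sum>l\<in>I. x i l * Y l m else 0))"
    have rel: "?L i j = ?R i j" if "i \<in> I" "j \<in> I" for i j
      using rtt_cross[OF rtt inv that I(3,4), of a b] unfolding D_def E_def x_def Y_def .
    have sum: "(\<Sum>i\<in>I. \<Sum>j\<in>I. signed (?s i j) (X q i * (?L i j * X j r)))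
        = (\<Sum>i\<in>I. \<Sum>j\<in>I. signed (?s i j) (X q i * (?R i j * X j r)))"
      by (intro sum.cong refl) (simp only: rel)
    have L1: "(\<Sum>i\<in>I. \<Sum>j\<in>I. signed (p i \<and> p m \<noteq> p n) (X q i * Y n m * x i j * X j r))
        = signed (p r \<and> p m \<noteq> p n) (X q r * Y n m)"
      using I fin by (simp add: signed_sum[symmetric] collapse if_distrib[of "signed _"] cong: sum.cong if_cong)
    have L2: "(\<Sum>i\<in>I. \<Sum>j\<in>I. signed (p j \<and> p m \<noteq> p n) (X q i * (x i j * (Y n m * X j r))))
        = signed (p q \<and> p m \<noteq> p n) (Y n m * X q r)"
      using I fin by (subst sum.swap) (simp add: signed_sum[symmetric] collapse if_distrib[of "signed _"] cong: sum.cong if_cong)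
    have "(\<Sum>i\<in>I. \<Sum>j\<in>I. signed (?s i j) (X q i * (?L i j * X j r)))
        = D * (\<Sum>i\<in>I. \<Sum>j\<in>I. signed (p i \<and> p m \<noteq> p n) (X q i * Y n m * x i j * X j r)
          - signed (p j \<and> p m \<noteq> p n) (X q i * (x i j * (Y n m * X j r))))"
      unfolding sum_distrib_left
    proof (intro sum.cong refl)
      fix i j
      have s: "(?s i j \<noteq> (p i \<noteq> p j \<and> p m)) \<longleftrightarrow> p i \<and> p m \<noteq> p n"
        "(?s i j \<noteq> (p i \<noteq> p j \<and> p n)) \<longleftrightarrow> p j \<and> p m \<noteq> p n" by blast+
      show "signed (?s i j) (X q i * (?L i j * X j r))
          = D * (signed (p i \<and> p m \<noteq> p n) (X q i * Y n m * x i j * X j r)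
            - signed (p j \<and> p m \<noteq> p n) (X q i * (x i j * (Y n m * X j r))))"
        by (simp only: mult.assoc D left_diff_distrib right_diff_distrib signed_mult signed_diff signed_signed s)
    qed
    then have lhs: "(\<Sum>i\<in>I. \<Sum>j\<in>I. signed (?s i j) (X q i * (?L i j * X j r)))
        = D * (signed (p r \<and> p m \<noteq> p n) (X q r * Y n m) - signed (p q \<and> p m \<noteq> p n) (Y n m * X q r))"
      by (simp only: sum_subtractf L1 L2)
    have R1: "(\<Sum>i\<in>I. \<Sum>j\<in>I. signed (?s i j \<noteq> (p i \<and> p j)) (X q i * ((if i = m then \<Sum>k\<in>I. Y n k * x k j else 0) * X j r)))
        = signed (p n \<and> p m) (X q m * Y n r)"
    proof -
      have "(\<Sum>i\<in>I. \<Sum>j\<in>I. signed (?s i j \<noteq> (p i \<and> p j)) (X q i * ((if i = m then \<Sum>k\<in>I. Y n k * x k j else 0) * X j r)))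
          = (\<Sum>i\<in>I. if i = m then \<Sum>j\<in>I. signed (p n \<and> p m) (X q m * ((\<Sum>k\<in>I. Y n k * x k j) * X j r)) else 0)"
        by (intro sum.cong refl) (auto intro!: sum.cong arg_cong[of _ _ "\<lambda>b. signed b _"])
      also have "\<dots> = signed (p n \<and> p m) (X q m * (\<Sum>j\<in>I. \<Sum>k\<in>I. Y n k * x k j * X j r))"
        using I fin by (simp add: signed_sum sum_distrib_left sum_distrib_right)
      also have "(\<Sum>j\<in>I. \<Sum>k\<in>I. Y n k * x k j * X j r) = Y n r"
        using I fin by (subst sum.swap) (simp add: collapse cong: sum.cong)
      finally show ?thesis .
    qed
    have R2: "(\<Sum>i\<in>I. \<Sum>j\<in>I. signed (?s i j \<noteq> (p i \<and> p j)) (X q i * ((if n = j then \<Sum>l\<in>I. x i l * Y l m else 0) * X j r)))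
        = signed (p n \<and> p m) (Y q m * X n r)"
    proof -
      have "(\<Sum>i\<in>I. \<Sum>j\<in>I. signed (?s i j \<noteq> (p i \<and> p j)) (X q i * ((if n = j then \<Sum>l\<in>I. x i l * Y l m else 0) * X j r)))
          = (\<Sum>i\<in>I. \<Sum>j\<in>I. if n = j then signed (p n \<and> p m) (X q i * (\<Sum>l\<in>I. x i l * Y l m) * X n r) else 0)"
        by (intro sum.cong refl) (auto simp: mult.assoc intro!: arg_cong[of _ _ "\<lambda>b. signed b _"])
      also have "\<dots> = signed (p n \<and> p m) ((\<Sum>i\<in>I. \<Sum>l\<in>I. X q i * (x i l * Y l m)) * X n r)"
        using I fin by (simp add: signed_sum sum_distrib_left sum_distrib_right)
      also have "(\<Sum>i\<in>I. \<Sum>l\<in>I. X q i * (x i l * Y l m)) = Y q m"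
        using I fin by (subst sum.swap) (simp add: collapse cong: sum.cong)
      finally show ?thesis .
    qed
    have "(\<Sum>i\<in>I. \<Sum>j\<in>I. signed (?s i j) (X q i * (?R i j * X j r)))
        = E * (\<Sum>i\<in>I. \<Sum>j\<in>I. signed (?s i j \<noteq> (p i \<and> p j)) (X q i * ((if i = m then \<Sum>k\<in>I. Y n k * x k j else 0) * X j r))
          - signed (?s i j \<noteq> (p i \<and> p j)) (X q i * ((if n = j then \<Sum>l\<in>I. x i l * Y l m else 0) * X j r)))"
      unfolding sum_distrib_left[of E]
      by (intro sum.cong refl)
        (simp only: mult.assoc E left_diff_distrib right_diff_distrib signed_mult signed_diff signed_signed)
    then have rhs: "(\<Sum>i\<in>I. \<Sum>j\<in>I. signed (?s i j) (X q i * (?R i j * X j r)))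
        = E * signed (p n \<and> p m) (X q m * Y n r - Y q m * X n r)"
      by (simp only: sum_subtractf R1 R2 signed_diff)
    show ?thesis
      using sum unfolding lhs rhs unfolding D_def E_def X_def Y_def .
  qed
  have "of_int (a - b) * (arg_shift a (y i j) * arg_shift b (y k l)
      - signed (p i \<noteq> p j \<and> p k \<noteq> p l) (arg_shift b (y k l) * arg_shift a (y i j)))
    = of_int (- \<epsilon>) * signed ((p i \<and> p j) \<noteq> ((p j \<and> p k) \<noteq> (p i \<and> p k)))
      (arg_shift a (y k j) * arg_shift b (y i l) - arg_shift b (y k j) * arg_shift a (y i l))"
    if "i \<in> I" "j \<in> I" "k \<in> I" "l \<in> I" for i j k l a b
    \<comment> \<open>Exchanging the two entries together with their arguments gives
      \<open>main\<close> the shape of \<open>rtt\<close>; the minus sign left over turns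
      \<open>\<epsilon>\<close> into \<open>- \<epsilon>\<close>.\<close>
    using main[OF that(3,4,1,2), of b a]
    by (cases "p i"; cases "p j"; cases "p k"; cases "p l") (simp_all add: algebra_simps)
  then show ?thesis by (simp add: rtt_def)
qed

subsection \<open>Elimination of one index\<close>

lemma rtt_mono: "rtt \<epsilon> p I t \<Longrightarrow> J \<subseteq> I \<Longrightarrow> rtt \<epsilon> p J t"
  unfolding rtt_def by blast

lemma rtt_unit_difference:
  fixes t :: "nat \<Rightarrow> nat \<Rightarrow> 'a::ring_1 fps"
  assumes "rtt \<epsilon> p I t" "\<epsilon> = 1 \<or> \<epsilon> = - 1" "i \<in> I" "j \<in> I" "k \<in> I" "l \<in> I"
  shows "arg_shift a (t i j) * arg_shift (a - \<epsilon>) (t k l)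
      - signed (p i \<noteq> p j \<and> p k \<noteq> p l) (arg_shift (a - \<epsilon>) (t k l) * arg_shift a (t i j))
    = signed ((p i \<and> p j) \<noteq> ((p j \<and> p k) \<noteq> (p i \<and> p k)))
      (arg_shift a (t k j) * arg_shift (a - \<epsilon>) (t i l) - arg_shift (a - \<epsilon>) (t k j) * arg_shift a (t i l))"
proof -
  have "of_int (a - (a - \<epsilon>)) * (arg_shift a (t i j) * arg_shift (a - \<epsilon>) (t k l)
      - signed (p i \<noteq> p j \<and> p k \<noteq> p l) (arg_shift (a - \<epsilon>) (t k l) * arg_shift a (t i j)))
    = of_int \<epsilon> * signed ((p i \<and> p j) \<noteq> ((p j \<and> p k) \<noteq> (p i \<and> p k)))
      (arg_shift a (t k j) * arg_shift (a - \<epsilon>) (t i l) - arg_shift (a - \<epsilon>) (t k j) * arg_shift a (t i l))"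
    using assms(1,3-6) unfolding rtt_def by blast
  moreover have "of_int \<epsilon> * A = of_int \<epsilon> * B \<Longrightarrow> A = B" for A B :: "'a fps"
    using assms(2) by auto
  ultimately show ?thesis by simp
qed

definition schur :: "nat \<Rightarrow> 'a \<Rightarrow> (nat \<Rightarrow> nat \<Rightarrow> 'a::ring_1) \<Rightarrow> nat \<Rightarrow> nat \<Rightarrow> 'a"
  where "schur x e t i j = t i j - t i x * e * t x j"

text \<open>Block inversion, read so that \<open>y\<close> is kept and only restricted, while
  \<open>t\<close> is replaced. Here \<open>e\<close> is the inverse of the pivot.\<close>

lemma inverse_on_schur:
  assumes inv: "inverse_on I t y" and x: "x \<in> I" and e: "t x x * e = 1" "e * t x x = 1"
  shows "inverse_on (I - {x}) (schur x e t) y"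
proof -
  have fin: "finite I" using inv by (rule inverse_on_finite)
  have rest: "(\<Sum>k\<in>I - {x}. f k) = (\<Sum>k\<in>I. f k) - f x" for f :: "nat \<Rightarrow> 'a"
    using fin x by (simp add: sum_diff1)
  note m = inverse_on_mult(1,2)[OF inv]
  have "(\<Sum>k\<in>I - {x}. schur x e t i k * y k j) = (if i = j then 1 else 0) \<and>
      (\<Sum>k\<in>I - {x}. y i k * schur x e t k j) = (if i = j then 1 else 0)"
    if ij: "i \<in> I - {x}" "j \<in> I - {x}" for i j
  proof
    have "(\<Sum>k\<in>I - {x}. schur x e t i k * y k j)
        = (\<Sum>k\<in>I - {x}. t i k * y k j) - t i x * e * (\<Sum>k\<in>I - {x}. t x k * y k j)"
      by (simp add: schur_def left_diff_distrib sum_subtractf sum_distrib_left mult.assoc)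
    also have "\<dots> = (if i = j then 1 else 0) - t i x * y x j + t i x * (e * t x x) * y x j"
      unfolding rest using ij x by (simp add: m mult.assoc)
    finally show "(\<Sum>k\<in>I - {x}. schur x e t i k * y k j) = (if i = j then 1 else 0)"
      by (simp add: e)
    have "(\<Sum>k\<in>I - {x}. y i k * schur x e t k j)
        = (\<Sum>k\<in>I - {x}. y i k * t k j) - (\<Sum>k\<in>I - {x}. y i k * t k x) * e * t x j"
      by (simp add: schur_def right_diff_distrib sum_subtractf sum_distrib_right mult.assoc)
    also have "\<dots> = (if i = j then 1 else 0) - y i x * t x j + y i x * (t x x * e) * t x j"
      unfolding rest using ij x by (simp add: m mult.assoc)
    finally show "(\<Sum>k\<in>I - {x}. y i k * schur x e t k j) = (if i = j then 1 else 0)"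
      by (simp add: e)
  qed
  with fin show ?thesis by (auto simp: inverse_on_def)
qed

lemma rtt_schur:
  assumes "rtt \<epsilon> p I t" "inverse_on I t y" "x \<in> I" "t x x * e = 1" "e * t x x = 1"
  shows "rtt \<epsilon> p (I - {x}) (schur x e t)"
  using rtt_inverse[OF rtt_mono[OF rtt_inverse[OF assms(1,2)] Diff_subset]
      inverse_on_sym[OF inverse_on_schur[OF assms(2-5)]]]
  by simp

text \<open>With the pivot as the entry of \<open>t\<close> in \<open>rtt_cross\<close>, both case
  distinctions on the right give 0, as \<open>i\<close> and \<open>j\<close> differ from
  \<open>x\<close>. So \<open>a - b\<close> annihilates the commutator, and equal shifts follow by
  polynomial dependence.\<close>

lemma pivot_commute_inverse:
  fixes t y :: "nat \<Rightarrow> nat \<Rightarrow> 'a::torsion_free_ring_1 fps"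
  assumes rtt: "rtt \<epsilon> p I t" and inv: "inverse_on I t y"
    and x: "x \<in> I" "\<not> p x" and ij: "i \<in> I - {x}" "j \<in> I - {x}"
  shows "arg_shift a (t x x) * arg_shift b (y i j) = arg_shift b (y i j) * arg_shift a (t x x)"
proof -
  have *: "arg_shift a (t x x) * arg_shift b (y i j) = arg_shift b (y i j) * arg_shift a (t x x)"
    if "a \<noteq> b" for a b
  proof -
    have "of_int (a - b) * (arg_shift b (y i j) * arg_shift a (t x x) - arg_shift a (t x x) * arg_shift b (y i j)) = 0"
      using rtt_cross[OF rtt inv x(1) x(1), of i j a b] x ij by auto
    then show ?thesis using that by (simp del: of_int_diff)
  qed
  show ?thesis
  proof (cases "a = b")
    case True
    have "arg_shift a (t x x) * arg_shift a (y i j) = arg_shift a (y i j) * arg_shift a (t x x)"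
      by (rule commute_if_commute_shifts) (simp add: *)
    with True show ?thesis by simp
  qed (rule *)
qed

text \<open>In matrix notation: t d = t d y t = t y d t = d t.\<close>

lemma commute_inverse_on:
  assumes inv: "inverse_on I t y"
    and comm: "\<And>i j. i \<in> I \<Longrightarrow> j \<in> I \<Longrightarrow> d * y i j = y i j * d"
    and ij: "i \<in> I" "j \<in> I"
  shows "d * t i j = t i j * d"
proof -
  have fin: "finite I" using inv by (rule inverse_on_finite)
  note m = inverse_on_mult[OF inv]
  have "t i j * d = (\<Sum>k\<in>I. \<Sum>l\<in>I. t i k * d * y k l * t l j)"
    using ij fin by (simp add: m cong: sum.cong)
  also have "\<dots> = (\<Sum>k\<in>I. \<Sum>l\<in>I. t i k * (y k l * (d * t l j)))"
  proof (intro sum.cong refl)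
    fix k l assume "k \<in> I" "l \<in> I"
    have "t i k * d * y k l * t l j = t i k * (d * y k l) * t l j"
      by (simp only: mult.assoc)
    then show "t i k * d * y k l * t l j = t i k * (y k l * (d * t l j))"
      by (simp only: comm[OF \<open>k \<in> I\<close> \<open>l \<in> I\<close>] mult.assoc)
  qed
  also have "\<dots> = d * t i j"
    using ij fin by (subst sum.swap) (simp add: m cong: sum.cong)
  finally show ?thesis by simp
qed

lemma pivot_commute_schur:
  fixes t y :: "nat \<Rightarrow> nat \<Rightarrow> 'a::torsion_free_ring_1 fps"
  assumes rtt: "rtt \<epsilon> p I t" and inv: "inverse_on I t y"
    and x: "x \<in> I" "\<not> p x" and e: "t x x * e = 1" "e * t x x = 1"
    and ij: "i \<in> I - {x}" "j \<in> I - {x}"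
  shows "arg_shift a (t x x) * arg_shift b (schur x e t i j) = arg_shift b (schur x e t i j) * arg_shift a (t x x)"
  by (rule commute_inverse_on[OF inverse_on_arg_shift[OF inverse_on_schur[OF inv x(1) e], of b] _ ij])
    (rule pivot_commute_inverse[OF rtt inv x])

text \<open>The bracket on the left is the transposed variant of the Schur complement that arises
  from \<open>z_relation\<close>. Writing d for the pivot and w = v - \<open>\<epsilon>\<close>,
  relation \<open>r1\<close> exchanges the arguments of d and of the entry (k, x), which removes the
  inverse pivot on both sides. What remains is \<open>r2\<close> combined with
  \<open>r3\<close>.\<close>

lemma schur_pivot_identity:
  assumes rtt: "rtt \<epsilon> p I t" and eps: "\<epsilon> = 1 \<or> \<epsilon> = - 1"
    and x: "x \<in> I" "\<not> p x" and e: "t x x * e = 1" "e * t x x = 1"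
    and kj: "k \<in> I" "j \<in> I"
  shows "(signed (p k \<and> p j) (arg_shift v (t k j)) - arg_shift v (t x j) * arg_shift v e * arg_shift v (t k x))
      * arg_shift (v - \<epsilon>) (t x x)
    = signed (p k \<and> p j) (arg_shift v (t x x) * arg_shift (v - \<epsilon>) (schur x e t k j))"
proof -
  define w where "w = v - \<epsilon>"
  let ?v = "\<lambda>i j. arg_shift v (t i j)" and ?w = "\<lambda>i j. arg_shift w (t i j)"
  have ev: "arg_shift v e * ?v x x = 1" and ew: "?w x x * arg_shift w e = 1"
    using e by (simp_all flip: arg_shift_mult)
  note r = rtt_unit_difference[OF rtt eps, of _ _ _ _ v, folded w_def]
  have r1: "?v x x * ?w k x = ?v k x * ?w x x"
    using r[OF x(1) x(1) kj(1) x(1)] x by simp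
  have r2: "?v x j * ?w k x - signed (p k \<and> p j) (?w k x * ?v x j)
      = signed (p k \<and> p j) (?v k j * ?w x x - ?w k j * ?v x x)"
    using r[OF x(1) kj(2) kj(1) x(1)] x by (simp add: conj_commute)
  have r3: "?v x x * ?w k j - ?w k j * ?v x x = ?v k x * ?w x j - ?w k x * ?v x j"
    using r[OF x(1) x(1) kj] x by simp
  have "?v x x * arg_shift w (schur x e t k j) = ?v x x * ?w k j - ?v x x * ?w k x * arg_shift w e * ?w x j"
    by (simp add: schur_def arg_shift_diff arg_shift_mult right_diff_distrib mult.assoc)
  also have "\<dots> = ?v x x * ?w k j - ?v k x * (?w x x * arg_shift w e) * ?w x j"
    by (simp only: r1 mult.assoc)
  finally have right: "?v x x * arg_shift w (schur x e t k j) = ?v x x * ?w k j - ?v k x * ?w x j"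
    by (simp add: ew)
  have "?v x j * arg_shift v e * ?v k x * ?w x x = ?v x j * (arg_shift v e * ?v x x) * ?w k x"
    by (simp only: mult.assoc r1)
  then have left: "?v x j * arg_shift v e * ?v k x * ?w x x = ?v x j * ?w k x"
    by (simp add: ev)
  have "signed c b1 - a1 = signed c (d1 - c1)"
    if 1: "a1 - signed c a2 = signed c (b1 - b2)" and 2: "d1 - b2 = c1 - a2" for c and a1 a2 b1 b2 c1 d1 :: "'a fps"
  proof -
    have "signed c b1 - a1 = signed c (b2 - a2)"
      using 1 by (simp add: signed_diff algebra_simps)
    moreover have "d1 - c1 = b2 - a2"
      using 2 by (simp add: algebra_simps)
    ultimately show ?thesis by simp
  qed
  from this[OF r2 r3] show ?thesis
    unfolding w_def[symmetric] left_diff_distrib left right signed_mult .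
qed

text \<open>The identities defining \<open>Z(u)\<close>, with \<open>P\<close> for \<open>M - N\<close>, in terms of the signed entries. They say
  nothing about \<open>Z\<close> when \<open>I\<close> is empty, hence the extra condition.\<close>

definition z_relation ::
    "(nat \<Rightarrow> bool) \<Rightarrow> nat set \<Rightarrow> int \<Rightarrow> (nat \<Rightarrow> nat \<Rightarrow> 'a::ring_1 fps) \<Rightarrow> (nat \<Rightarrow> nat \<Rightarrow> 'a fps) \<Rightarrow> 'a fps \<Rightarrow> bool"
  where "z_relation p I P t y Z \<longleftrightarrow> (I = {} \<longrightarrow> Z = 1) \<and> (\<forall>i\<in>I. \<forall>j\<in>I.
    (\<Sum>k\<in>I. signed (p k \<and> p i = p j) (arg_shift P (t k j) * y i k)) = (if i = j then signed (p j) Z else 0))"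

text \<open>Gaussian elimination: the equation for (i, x) is solved for \<open>y i x\<close> and
  inserted into the one for (i, j). Multiplication by the pivot at u + P - \<open>\<epsilon>\<close>
  from the right, where it commutes with the remaining \<open>y i k\<close>, makes
  \<open>schur_pivot_identity\<close> applicable.\<close>

lemma z_relation_schur:
  fixes t y :: "nat \<Rightarrow> nat \<Rightarrow> 'a::torsion_free_ring_1 fps"
  assumes rtt: "rtt \<epsilon> p I t" and eps: "\<epsilon> = 1 \<or> \<epsilon> = - 1" and inv: "inverse_on I t y"
    and x: "x \<in> I" "\<not> p x" and e: "t x x * e = 1" "e * t x x = 1"
    and z: "z_relation p I P t y Z" and P: "I = {x} \<Longrightarrow> P = \<epsilon>"
  shows "z_relation p (I - {x}) (P - \<epsilon>) (schur x e t) y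
    (arg_shift P e * Z * arg_shift (P - \<epsilon>) (t x x))"
proof -
  let ?P = "\<lambda>i j. arg_shift P (t i j)" and ?d = "arg_shift (P - \<epsilon>) (t x x)"
  let ?s = "\<lambda>i j. arg_shift (P - \<epsilon>) (schur x e t i j)"
  have fin: "finite I" using inv by (rule inverse_on_finite)
  have eP: "arg_shift P e * ?P x x = 1"
    using e by (simp flip: arg_shift_mult)
  have split: "(\<Sum>k\<in>I. f k) = f x + (\<Sum>k\<in>I - {x}. f k)" for f :: "nat \<Rightarrow> 'a fps"
    using fin x by (simp add: sum.remove)
  have zz: "(\<Sum>k\<in>I. signed (p k \<and> p i = p j) (?P k j * y i k)) = (if i = j then signed (p j) Z else 0)"
    if "i \<in> I" "j \<in> I" for i j
    using z that by (simp add: z_relation_def)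
  have "(\<Sum>k\<in>I - {x}. signed (p k \<and> p i = p j) (?s k j * y i k))
      = (if i = j then signed (p j) (arg_shift P e * Z * ?d) else 0)"
    if ij: "i \<in> I - {x}" "j \<in> I - {x}" for i j
  proof -
    let ?H = "\<lambda>k. signed (p k \<and> p j) (?P k j) - ?P x j * arg_shift P e * ?P k x"
    let ?S = "\<Sum>k\<in>I - {x}. signed (p k \<and> \<not> p i) (?P k x * y i k)"
    have "?P x x * y i x + ?S = 0"
      using zz[of i x] ij x by (simp add: split)
    then have "?P x x * y i x = - ?S"
      by (simp only: eq_neg_iff_add_eq_0)
    then have "arg_shift P e * (?P x x * y i x) = - (arg_shift P e * ?S)"
      by simp
    then have yix: "y i x = - (arg_shift P e * ?S)"
      by (simp add: eP flip: mult.assoc)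
    have "(if i = j then signed (p j) Z else 0)
        = ?P x j * y i x + (\<Sum>k\<in>I - {x}. signed (p k \<and> p i = p j) (?P k j * y i k))"
      using zz[of i j] ij x by (simp add: split)
    also have "\<dots> = (\<Sum>k\<in>I - {x}. signed (p k \<and> p i = p j) (?P k j * y i k)
        - signed (p k \<and> \<not> p i) (?P x j * arg_shift P e * ?P k x * y i k))"
      unfolding yix sum_subtractf by (simp add: sum_distrib_left signed_mult mult.assoc)
    also have "\<dots> = (\<Sum>k\<in>I - {x}. signed (p k \<and> \<not> p i) (?H k * y i k))"
      by (intro sum.cong refl)
        (auto simp: left_diff_distrib signed_diff signed_mult intro!: arg_cong[of _ _ "\<lambda>b. signed b _"])
    finally have *: "(if i = j then signed (p j) Z else 0)
        = (\<Sum>k\<in>I - {x}. signed (p k \<and> \<not> p i) (?H k * y i k))" .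
    have "(if i = j then signed (p j) Z else 0) * ?d
        = (\<Sum>k\<in>I - {x}. signed (p k \<and> \<not> p i) (?H k * ?d * y i k))"
      unfolding * sum_distrib_right signed_mult
    proof (intro sum.cong refl)
      fix k assume "k \<in> I - {x}"
      then have "y i k * ?d = ?d * y i k"
        using pivot_commute_inverse[OF rtt inv x ij(1), of k "P - \<epsilon>" 0] by simp
      then show "signed (p k \<and> \<not> p i) (?H k * y i k * ?d) = signed (p k \<and> \<not> p i) (?H k * ?d * y i k)"
        by (simp only: mult.assoc)
    qed
    also have "\<dots> = (\<Sum>k\<in>I - {x}. signed (p k \<and> p i = p j) (?P x x * ?s k j * y i k))"
    proof (intro sum.cong refl)
      fix k assume "k \<in> I - {x}"
      then have "?H k * ?d = signed (p k \<and> p j) (?P x x * ?s k j)"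
        using schur_pivot_identity[OF rtt eps x e] ij by simp
      moreover have "(p k \<and> \<not> p i) \<noteq> (p k \<and> p j) \<longleftrightarrow> p k \<and> p i = p j" by blast
      ultimately show "signed (p k \<and> \<not> p i) (?H k * ?d * y i k) = signed (p k \<and> p i = p j) (?P x x * ?s k j * y i k)"
        by (simp only: signed_mult signed_signed)
    qed
    also have "\<dots> = ?P x x * (\<Sum>k\<in>I - {x}. signed (p k \<and> p i = p j) (?s k j * y i k))"
      by (simp add: sum_distrib_left signed_mult mult.assoc)
    finally have "arg_shift P e * ((if i = j then signed (p j) Z else 0) * ?d)
        = arg_shift P e * (?P x x * (\<Sum>k\<in>I - {x}. signed (p k \<and> p i = p j) (?s k j * y i k)))"
      by (simp only:)
    moreover have "arg_shift P e * (?P x x * T) = T" for T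
      by (simp add: eP flip: mult.assoc)
    ultimately have "(\<Sum>k\<in>I - {x}. signed (p k \<and> p i = p j) (?s k j * y i k))
        = arg_shift P e * ((if i = j then signed (p j) Z else 0) * ?d)"
      by (simp only:)
    then show ?thesis
      by (cases "i = j") (simp_all add: signed_mult mult.assoc)
  qed
  \<comment> \<open>When the last index goes, the new series has to be 1. Then \<open>Z\<close> is
    the pivot at u + P times its inverse at u, and \<open>P = \<epsilon>\<close> puts
    \<open>?d\<close> at u, so everything cancels.\<close>
  moreover have "arg_shift P e * Z * ?d = 1" if "I - {x} = {}"
  proof -
    have Ix: "I = {x}" using that x by blast
    with P have "P = \<epsilon>" by simp
    have "Z = ?P x x * y x x"
      using zz[of x x] x by (simp add: Ix)
    moreover have "y x x * t x x = 1"
      using inverse_on_mult(2)[OF inv x(1) x(1)] by (simp add: Ix)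
    ultimately have "arg_shift P e * Z * ?d = arg_shift P e * ?P x x * (y x x * t x x)"
      using \<open>P = \<epsilon>\<close> by (simp add: mult.assoc)
    then show ?thesis using \<open>y x x * t x x = 1\<close> by (simp add: eP)
  qed
  ultimately show ?thesis
    by (auto simp: z_relation_def)
qed

subsection \<open>Noncommutative determinants\<close>

text \<open>A column determinant: the factors stand in the order of the columns \<open>k\<close>,
  and \<open>F k a\<close> is the entry of column \<open>k\<close> in row \<open>a\<close>, so each
  column can carry its own spectral parameter.\<close>

definition ndet :: "nat \<Rightarrow> nat \<Rightarrow> (nat \<Rightarrow> nat \<Rightarrow> 'a::ring_1) \<Rightarrow> 'a"
  where "ndet m n F = (\<Sum>\<sigma> | \<sigma> permutes {m..<n}. of_int (sign \<sigma>) * (\<Prod>k\<leftarrow>[m..<n]. F k (\<sigma> k)))"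

lemma ndet_cong:
  assumes "\<And>k a. k \<in> {m..<n} \<Longrightarrow> a \<in> {m..<n} \<Longrightarrow> F k a = G k a"
  shows "ndet m n F = ndet m n G"
proof -
  have "map (\<lambda>k. F k (\<sigma> k)) [m..<n] = map (\<lambda>k. G k (\<sigma> k)) [m..<n]" if "\<sigma> permutes {m..<n}" for \<sigma>
    using assms permutes_in_image[OF that] by (intro map_cong) auto
  then show ?thesis
    unfolding ndet_def by (intro sum.cong refl) (simp only: mem_Collect_eq)
qed

lemma upt_split: "m \<le> j \<Longrightarrow> j < n \<Longrightarrow> [m..<n] = [m..<j] @ j # [Suc j..<n]"
  using upt_add_eq_append[of m j "n - j"] by (simp add: upt_conv_Cons)

lemma ndet_sum_first_column:
  assumes "m < n"
  shows "ndet m n (F(m := \<lambda>a. \<Sum>c\<in>C. x c * G c a)) = (\<Sum>c\<in>C. x c * ndet m n (F(m := G c)))"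
proof -
  have prod: "(\<Prod>k\<leftarrow>[m..<n]. (F(m := H)) k (\<sigma> k)) = H (\<sigma> m) * (\<Prod>k\<leftarrow>[Suc m..<n]. F k (\<sigma> k))" for H and \<sigma>
  proof -
    have "map (\<lambda>k. (F(m := H)) k (\<sigma> k)) [Suc m..<n] = map (\<lambda>k. F k (\<sigma> k)) [Suc m..<n]"
      by (intro map_cong) auto
    then show ?thesis
      using assms by (simp only: upt_conv_Cons list.map prod_list.Cons fun_upd_same)
  qed
  show ?thesis
    unfolding ndet_def prod sum_distrib_left sum_distrib_right
    by (subst sum.swap) (intro sum.cong refl, simp only: mult.assoc of_int_left_commute)
qed

lemma prod_list_fun_upd:
  fixes F :: "nat \<Rightarrow> nat \<Rightarrow> 'a::monoid_mult"
  assumes "m \<le> j" "j < n"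
  shows "(\<Prod>k\<leftarrow>[m..<n]. (F(j := H)) k (\<sigma> k))
    = (\<Prod>k\<leftarrow>[m..<j]. F k (\<sigma> k)) * (H (\<sigma> j) * (\<Prod>k\<leftarrow>[Suc j..<n]. F k (\<sigma> k)))"
proof -
  have "map (\<lambda>k. (F(j := H)) k (\<sigma> k)) [m..<j] = map (\<lambda>k. F k (\<sigma> k)) [m..<j]"
    "map (\<lambda>k. (F(j := H)) k (\<sigma> k)) [Suc j..<n] = map (\<lambda>k. F k (\<sigma> k)) [Suc j..<n]"
    by (auto intro: map_cong)
  then show ?thesis
    by (simp only: upt_split[OF assms] map_append list.map prod_list.append prod_list.Cons fun_upd_same)
qed

lemma ndet_diff_column:
  assumes "m \<le> j" "j < n"
  shows "ndet m n (F(j := \<lambda>a. G a - H a)) = ndet m n (F(j := G)) - ndet m n (F(j := H))"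
  unfolding ndet_def prod_list_fun_upd[OF assms]
  by (simp only: left_diff_distrib right_diff_distrib sum_subtractf)

text \<open>Pairing each permutation with its composite with the transposition expresses twice the
  determinant through antisymmetrised products of the two columns, to which \<open>anti\<close>
  applies. The factor 2 is then cancelled.\<close>

lemma ndet_swap_adjacent_columns:
  fixes F :: "nat \<Rightarrow> nat \<Rightarrow> 'a::torsion_free_ring_1"
  assumes j: "m \<le> j" "Suc j < n"
    and anti: "\<And>a b. a \<in> {m..<n} \<Longrightarrow> b \<in> {m..<n} \<Longrightarrow> G a * H b - G b * H a = - (G' a * H' b - G' b * H' a)"
  shows "ndet m n (F(j := G, Suc j := H)) = - ndet m n (F(j := G', Suc j := H'))"
proof -
  let ?\<tau> = "transpose j (Suc j)"
  let ?S = "{\<sigma>. \<sigma> permutes {m..<n}}"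
  let ?A = "\<lambda>\<sigma>. \<Prod>k\<leftarrow>[m..<j]. F k (\<sigma> k)" and ?B = "\<lambda>\<sigma>. \<Prod>k\<leftarrow>[Suc (Suc j)..<n]. F k (\<sigma> k)"
  have \<tau>: "?\<tau> permutes {m..<n}"
    using j by (intro permutes_swap_id) auto
  have prod: "(\<Prod>k\<leftarrow>[m..<n]. (F(j := G, Suc j := H)) k (\<sigma> k)) = ?A \<sigma> * (G (\<sigma> j) * H (\<sigma> (Suc j))) * ?B \<sigma>" for G H \<sigma>
  proof -
    have "map (\<lambda>k. (F(j := G)) k (\<sigma> k)) [Suc (Suc j)..<n] = map (\<lambda>k. F k (\<sigma> k)) [Suc (Suc j)..<n]"
      by (intro map_cong) auto
    moreover have "(\<Prod>k\<leftarrow>[m..<Suc j]. (F(j := G)) k (\<sigma> k)) = ?A \<sigma> * G (\<sigma> j)"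
      using prod_list_fun_upd[of m j "Suc j" F G \<sigma>] j by (simp del: fun_upd_apply)
    moreover have "m \<le> Suc j" using j by simp
    ultimately show ?thesis
      by (simp only: prod_list_fun_upd[of m "Suc j" n "F(j := G)", OF _ j(2)] mult.assoc)
  qed
  have prod': "(\<Prod>k\<leftarrow>[m..<n]. (F(j := G, Suc j := H)) k ((\<sigma> \<circ> ?\<tau>) k)) = ?A \<sigma> * (G (\<sigma> (Suc j)) * H (\<sigma> j)) * ?B \<sigma>" for G H \<sigma>
  proof -
    have "map (\<lambda>k. F k ((\<sigma> \<circ> ?\<tau>) k)) [m..<j] = map (\<lambda>k. F k (\<sigma> k)) [m..<j]"
      "map (\<lambda>k. F k ((\<sigma> \<circ> ?\<tau>) k)) [Suc (Suc j)..<n] = map (\<lambda>k. F k (\<sigma> k)) [Suc (Suc j)..<n]"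
      by (auto intro!: map_cong simp: transpose_apply_other)
    then show ?thesis by (simp only: prod) simp
  qed
  have double: "of_int 2 * ndet m n (F(j := G, Suc j := H))
      = (\<Sum>\<sigma>\<in>?S. of_int (sign \<sigma>) * (?A \<sigma> * (G (\<sigma> j) * H (\<sigma> (Suc j)) - G (\<sigma> (Suc j)) * H (\<sigma> j)) * ?B \<sigma>))" for G H
  proof -
    have "ndet m n (F(j := G, Suc j := H))
        = (\<Sum>\<sigma>\<in>?S. of_int (sign (\<sigma> \<circ> ?\<tau>)) * (\<Prod>k\<leftarrow>[m..<n]. (F(j := G, Suc j := H)) k ((\<sigma> \<circ> ?\<tau>) k)))"
      unfolding ndet_def by (rule sum_permutations_compose_right[OF \<tau>])
    also have "\<dots> = (\<Sum>\<sigma>\<in>?S. - (of_int (sign \<sigma>) * (?A \<sigma> * (G (\<sigma> (Suc j)) * H (\<sigma> j)) * ?B \<sigma>)))"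
    proof (intro sum.cong refl)
      fix \<sigma> assume "\<sigma> \<in> ?S"
      then have "permutation \<sigma>" by (auto simp: permutation_permutes)
      then have "sign (\<sigma> \<circ> ?\<tau>) = - sign \<sigma>"
        by (simp add: sign_compose permutation_swap_id sign_swap_id)
      then show "of_int (sign (\<sigma> \<circ> ?\<tau>)) * (\<Prod>k\<leftarrow>[m..<n]. (F(j := G, Suc j := H)) k ((\<sigma> \<circ> ?\<tau>) k))
          = - (of_int (sign \<sigma>) * (?A \<sigma> * (G (\<sigma> (Suc j)) * H (\<sigma> j)) * ?B \<sigma>))"
        unfolding prod' by simp
    qed
    finally have 1: "ndet m n (F(j := G, Suc j := H))
        = - (\<Sum>\<sigma>\<in>?S. of_int (sign \<sigma>) * (?A \<sigma> * (G (\<sigma> (Suc j)) * H (\<sigma> j)) * ?B \<sigma>))"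
      by (simp only: sum_negf)
    have 2: "ndet m n (F(j := G, Suc j := H))
        = (\<Sum>\<sigma>\<in>?S. of_int (sign \<sigma>) * (?A \<sigma> * (G (\<sigma> j) * H (\<sigma> (Suc j))) * ?B \<sigma>))"
      unfolding ndet_def prod ..
    have "of_int 2 * ndet m n (F(j := G, Suc j := H))
        = ndet m n (F(j := G, Suc j := H)) + ndet m n (F(j := G, Suc j := H))"
      by (simp add: mult_2)
    also have "\<dots> = (\<Sum>\<sigma>\<in>?S. of_int (sign \<sigma>) * (?A \<sigma> * (G (\<sigma> j) * H (\<sigma> (Suc j))) * ?B \<sigma>))
        - (\<Sum>\<sigma>\<in>?S. of_int (sign \<sigma>) * (?A \<sigma> * (G (\<sigma> (Suc j)) * H (\<sigma> j)) * ?B \<sigma>))"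
      by (subst (2) 1, subst 2) simp
    finally show ?thesis
      by (simp only: right_diff_distrib left_diff_distrib sum_subtractf)
  qed
  have "of_int 2 * (ndet m n (F(j := G, Suc j := H)) + ndet m n (F(j := G', Suc j := H'))) = 0"
    unfolding distrib_left double sum.distrib[symmetric]
  proof (intro sum.neutral ballI)
    fix \<sigma> assume "\<sigma> \<in> ?S"
    then have "\<sigma> j \<in> {m..<n}" "\<sigma> (Suc j) \<in> {m..<n}"
      using j permutes_in_image by fastforce+
    from anti[OF this] show "of_int (sign \<sigma>) * (?A \<sigma> * (G (\<sigma> j) * H (\<sigma> (Suc j)) - G (\<sigma> (Suc j)) * H (\<sigma> j)) * ?B \<sigma>)
        + of_int (sign \<sigma>) * (?A \<sigma> * (G' (\<sigma> j) * H' (\<sigma> (Suc j)) - G' (\<sigma> (Suc j)) * H' (\<sigma> j)) * ?B \<sigma>) = 0"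
      by (simp only: mult_minus_left mult_minus_right left_minus)
  qed
  then show ?thesis
    unfolding of_int_mult_eq_0_iff by (simp add: eq_neg_iff_add_eq_0)
qed

text \<open>\<open>W k c\<close> is the column with label \<open>c\<close> of the matrix at the spectral parameter of the \<open>k\<close>-th factor.\<close>

definition antisym_columns :: "nat \<Rightarrow> nat \<Rightarrow> (nat \<Rightarrow> nat \<Rightarrow> nat \<Rightarrow> 'a::ring_1) \<Rightarrow> bool"
  where "antisym_columns m n W \<longleftrightarrow> (\<forall>j c d a b. {j, Suc j, c, d, a, b} \<subseteq> {m..<n} \<longrightarrow>
    W j c a * W (Suc j) d b - W j c b * W (Suc j) d a
      = - (W j d a * W (Suc j) c b - W j d b * W (Suc j) c a))"

text \<open>The second copy of the label is moved left by adjacent swaps until it meets the first,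
  where a swap only changes the sign. Spectral parameters and the right factor \<open>x\<close> stay
  at their positions while labels move, so after one swap the copy has right factor 1.\<close>

lemma ndet_repeated_column:
  fixes W :: "nat \<Rightarrow> nat \<Rightarrow> nat \<Rightarrow> 'a::torsion_free_ring_1"
  assumes anti: "antisym_columns m n W" and i: "m \<le> i" "i < q" and q: "q < n"
    and f: "\<And>k. k \<in> {i..<q} \<Longrightarrow> f k \<in> {m..<n}"
    and F: "\<And>k a. k \<in> {i..<q} \<Longrightarrow> F k a = W k (f k) a" "\<And>a. F q a = W q (f i) a * x"
  shows "ndet m n F = 0"
proof -
  have "Suc i \<le> q" using i(2) by simp
  from this q f F show ?thesis
  proof (induction q arbitrary: F x rule: dec_induct)
    case base
    have "F(i := F i, Suc i := F (Suc i)) = F" by simp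
    moreover have "ndet m n (F(i := F i, Suc i := F (Suc i))) = - ndet m n (F(i := F i, Suc i := F (Suc i)))"
    proof (rule ndet_swap_adjacent_columns)
      fix a b assume ab: "a \<in> {m..<n}" "b \<in> {m..<n}"
      have "W i (f i) a * W (Suc i) (f i) b - W i (f i) b * W (Suc i) (f i) a
          = - (W i (f i) a * W (Suc i) (f i) b - W i (f i) b * W (Suc i) (f i) a)"
        using anti i(1) base ab unfolding antisym_columns_def by simp
      from arg_cong[OF this, of "\<lambda>z. z * x"]
      show "F i a * F (Suc i) b - F i b * F (Suc i) a = - (F i a * F (Suc i) b - F i b * F (Suc i) a)"
        using base by (simp add: left_diff_distrib mult.assoc)
    qed (use i(1) base in auto)
    ultimately have "ndet m n F = - ndet m n F" by (simp only:)
    then have "ndet m n F + ndet m n F = 0" by (simp only: eq_neg_iff_add_eq_0)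
    then have "of_int 2 * ndet m n F = 0" by (simp add: mult_2)
    then show ?case unfolding of_int_mult_eq_0_iff by simp
  next
    case (step q)
    let ?F = "F(q := W q (f i), Suc q := \<lambda>a. W (Suc q) (f q) a * x)"
    have "F(q := F q, Suc q := F (Suc q)) = F" by simp
    moreover have "ndet m n (F(q := F q, Suc q := F (Suc q))) = - ndet m n ?F"
    proof (rule ndet_swap_adjacent_columns)
      fix a b assume ab: "a \<in> {m..<n}" "b \<in> {m..<n}"
      have "f i \<in> {m..<n}" "f q \<in> {m..<n}" using step by auto
      then have "W q (f q) a * W (Suc q) (f i) b - W q (f q) b * W (Suc q) (f i) a
          = - (W q (f i) a * W (Suc q) (f q) b - W q (f i) b * W (Suc q) (f q) a)"
        using anti i(1) step.hyps step.prems(1) ab unfolding antisym_columns_def by simp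
      from arg_cong[OF this, of "\<lambda>z. z * x"]
      show "F q a * F (Suc q) b - F q b * F (Suc q) a
          = - (W q (f i) a * (W (Suc q) (f q) b * x) - W q (f i) b * (W (Suc q) (f q) a * x))"
        using step.hyps step.prems by (simp add: left_diff_distrib mult.assoc)
    qed (use i(1) step in auto)
    moreover have "ndet m n ?F = 0"
      by (rule step.IH[of _ 1]) (use step in auto)
    ultimately show ?case by (simp only: minus_zero)
  qed
qed

lemma prod_list_eq_0: "0 \<in> set xs \<Longrightarrow> prod_list xs = (0 :: 'a::semiring_1)"
  by (induction xs) auto

text \<open>Serves both for a row \<open>m\<close> that vanishes after its first entry and for a
  first column that vanishes below its first entry.\<close>

lemma ndet_fixed_first:
  assumes "m < n"
    and zero: "\<And>\<sigma>. \<sigma> permutes {m..<n} \<Longrightarrow> \<sigma> m \<noteq> m \<Longrightarrow> \<exists>k\<in>{m..<n}. F k (\<sigma> k) = 0"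
  shows "ndet m n F = F m m * ndet (Suc m) n F"
proof -
  have "ndet m n F = (\<Sum>\<sigma> | \<sigma> permutes {Suc m..<n}. of_int (sign \<sigma>) * (\<Prod>k\<leftarrow>[m..<n]. F k (\<sigma> k)))"
    unfolding ndet_def
  proof (rule sum.mono_neutral_right)
    show "finite {\<sigma>. \<sigma> permutes {m..<n}}" by (simp add: finite_permutations)
    show "{\<sigma>. \<sigma> permutes {Suc m..<n}} \<subseteq> {\<sigma>. \<sigma> permutes {m..<n}}"
      by (auto intro: permutes_subset)
    show "\<forall>\<sigma>\<in>{\<sigma>. \<sigma> permutes {m..<n}} - {\<sigma>. \<sigma> permutes {Suc m..<n}}.
        of_int (sign \<sigma>) * (\<Prod>k\<leftarrow>[m..<n]. F k (\<sigma> k)) = 0"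
    proof
      fix \<sigma> assume \<sigma>: "\<sigma> \<in> {\<sigma>. \<sigma> permutes {m..<n}} - {\<sigma>. \<sigma> permutes {Suc m..<n}}"
      have "\<sigma> m \<noteq> m"
      proof
        assume "\<sigma> m = m"
        with \<sigma> have "\<sigma> permutes {Suc m..<n}"
          by (auto intro!: permutes_superset[of \<sigma> "{m..<n}"]) (metis le_antisym not_less_eq_eq)
        with \<sigma> show False by simp
      qed
      with zero[of \<sigma>] \<sigma> obtain k where "k \<in> {m..<n}" "F k (\<sigma> k) = 0" by auto
      then have "0 \<in> set (map (\<lambda>k. F k (\<sigma> k)) [m..<n])" by force
      then show "of_int (sign \<sigma>) * (\<Prod>k\<leftarrow>[m..<n]. F k (\<sigma> k)) = 0"
        by (simp add: prod_list_eq_0)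
    qed
  qed
  also have "\<dots> = (\<Sum>\<sigma> | \<sigma> permutes {Suc m..<n}. F m m * (of_int (sign \<sigma>) * (\<Prod>k\<leftarrow>[Suc m..<n]. F k (\<sigma> k))))"
  proof (intro sum.cong refl)
    fix \<sigma> assume "\<sigma> \<in> {\<sigma>. \<sigma> permutes {Suc m..<n}}"
    then have "\<sigma> m = m" by (auto dest: permutes_not_in[of _ _ m])
    then show "of_int (sign \<sigma>) * (\<Prod>k\<leftarrow>[m..<n]. F k (\<sigma> k))
        = F m m * (of_int (sign \<sigma>) * (\<Prod>k\<leftarrow>[Suc m..<n]. F k (\<sigma> k)))"
      using assms(1) by (simp only: upt_conv_Cons list.map prod_list.Cons of_int_left_commute)
  qed
  finally show ?thesis by (simp add: ndet_def sum_distrib_left)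
qed

text \<open>Column operations: the correction subtracted from column \<open>k\<close> is the column
  labelled \<open>m\<close> at the same argument, times \<open>z k\<close> on the right. It repeats
  the label \<open>m\<close> and contributes 0; afterwards row \<open>m\<close> vanishes after its
  first entry.\<close>

lemma ndet_schur:
  fixes W :: "nat \<Rightarrow> nat \<Rightarrow> nat \<Rightarrow> 'a::torsion_free_ring_1"
  assumes anti: "antisym_columns m n W" and m: "m < n"
    and V: "\<And>k a. k \<in> {Suc m..<n} \<Longrightarrow> V k a = W k k a - W k m a * z k"
    and zero: "\<And>k. k \<in> {Suc m..<n} \<Longrightarrow> V k m = 0"
  shows "ndet m n (\<lambda>k. W k k) = W m m m * ndet (Suc m) n V"
proof -
  \<comment> \<open>In \<open>F q\<close> the columns from \<open>q\<close> on are reduced.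
    Proceeding from the last column downwards keeps the columns before \<open>q\<close> in the form
    \<open>W k k\<close> that \<open>ndet_repeated_column\<close> requires.\<close>
  define F where "F q k = (if k < q then W k k else V k)" for q k
  have "ndet m n (F q) = ndet m n (F (Suc m))" if "Suc m \<le> q" "q \<le> n" for q
    using that
  proof (induction q rule: dec_induct)
    case (step q)
    have "F q = (F (Suc q))(q := \<lambda>a. W q q a - W q m a * z q)"
      using step V[of q] by (auto simp: F_def fun_eq_iff)
    then have "ndet m n (F q) = ndet m n ((F (Suc q))(q := W q q)) - ndet m n ((F (Suc q))(q := \<lambda>a. W q m a * z q))"
      using ndet_diff_column[of m q n "F (Suc q)"] step by simp
    moreover have "(F (Suc q))(q := W q q) = F (Suc q)"
      by (auto simp: F_def)
    moreover have "ndet m n ((F (Suc q))(q := \<lambda>a. W q m a * z q)) = 0"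
      by (rule ndet_repeated_column[OF anti, of m q "\<lambda>k. k" _ "z q"]) (use step in \<open>auto simp: F_def\<close>)
    ultimately show ?case using step by simp
  qed simp
  from this[of n] have "ndet m n (F n) = ndet m n (F (Suc m))"
    using m by simp
  also have "\<dots> = F (Suc m) m m * ndet (Suc m) n (F (Suc m))"
  proof (rule ndet_fixed_first[OF m])
    fix \<sigma> assume \<sigma>: "\<sigma> permutes {m..<n}" "\<sigma> m \<noteq> m"
    let ?k = "inv \<sigma> m"
    have "?k \<in> {m..<n}" "\<sigma> ?k = m"
      using permutes_in_image[OF permutes_inv[OF \<sigma>(1)], of m] permutes_inverses[OF \<sigma>(1)] m by auto
    moreover from this \<sigma>(2) have "?k \<noteq> m" by metis
    ultimately show "\<exists>k\<in>{m..<n}. F (Suc m) k (\<sigma> k) = 0"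
      using zero[of ?k] by (intro bexI[of _ ?k]) (auto simp: F_def)
  qed
  also have "ndet (Suc m) n (F (Suc m)) = ndet (Suc m) n V"
    by (rule ndet_cong) (simp add: F_def)
  also have "ndet m n (F n) = ndet m n (\<lambda>k. W k k)"
    by (rule ndet_cong) (simp add: F_def)
  finally show ?thesis by (simp add: F_def)
qed

text \<open>In the manner of Cramer's rule: the first column is replaced by the combination with
  left coefficients \<open>x c\<close>, a unit vector. Terms with \<open>c \<noteq> m\<close> repeat
  the label \<open>c\<close> and vanish; left coefficients come out because this column is the first
  factor.\<close>

lemma ndet_left_inverse:
  fixes W :: "nat \<Rightarrow> nat \<Rightarrow> nat \<Rightarrow> 'a::torsion_free_ring_1"
  assumes anti: "antisym_columns m n W" and m: "m < n"
    and inv: "\<And>a. a \<in> {m..<n} \<Longrightarrow> (\<Sum>c\<in>{m..<n}. x c * W m c a) = (if a = m then 1 else 0)"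
  shows "x m * ndet m n (\<lambda>k. W k k) = ndet (Suc m) n (\<lambda>k. W k k)"
proof -
  let ?F = "\<lambda>k. W k k"
  let ?G = "?F(m := \<lambda>a. \<Sum>c\<in>{m..<n}. x c * W m c a)"
  have vanish: "ndet m n (?F(m := W m c)) = 0" if "c \<in> {m..<n} - {m}" for c
    by (rule ndet_repeated_column[OF anti, of m c "(\<lambda>k. k)(m := c)" _ 1]) (use that in auto)
  have "ndet m n ?G = (\<Sum>c\<in>{m..<n}. x c * ndet m n (?F(m := W m c)))"
    by (rule ndet_sum_first_column[OF m])
  also have "\<dots> = x m * ndet m n (?F(m := W m m)) + (\<Sum>c\<in>{m..<n} - {m}. x c * ndet m n (?F(m := W m c)))"
    using m by (intro sum.remove) auto
  also have "\<dots> = x m * ndet m n ?F"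
    using vanish by (simp add: fun_upd_idem)
  finally have "x m * ndet m n ?F = ndet m n ?G" by simp
  also have "\<dots> = ?G m m * ndet (Suc m) n ?G"
  proof (rule ndet_fixed_first[OF m])
    fix \<sigma> assume \<sigma>: "\<sigma> permutes {m..<n}" "\<sigma> m \<noteq> m"
    have "\<sigma> m \<in> {m..<n}"
      using permutes_in_image[OF \<sigma>(1), of m] m by auto
    with m inv[of "\<sigma> m"] \<sigma>(2) show "\<exists>k\<in>{m..<n}. ?G k (\<sigma> k) = 0"
      by (intro bexI[of _ m]) simp_all
  qed
  also have "ndet (Suc m) n ?G = ndet (Suc m) n ?F"
    by (rule ndet_cong) simp
  finally show ?thesis using inv[of m] m by simp
qed

subsection \<open>The Yangian\<close>

instance yangian :: (len0, len0) torsion_free_ring_1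
proof
  fix n and x :: "('a, 'b) yangian"
  assume *: "of_nat n * x = 0"
  show "n = 0 \<or> x = 0"
  proof (rule disjCI)
    assume "x \<noteq> 0"
    show "n = 0"
    proof (rule ccontr)
      assume n: "n \<noteq> 0"
      have of_nat: "abs_yangian (of_nat k) = (of_nat k :: ('a, 'b) yangian)" for k
        by (induction k) (simp_all flip: zero_yangian.abs_eq one_yangian.abs_eq plus_yangian.abs_eq)
      have "Poly_Mapping.single 0 (1 / of_nat n) * of_nat n = (1 :: gen_algebra)"
        using n by (simp add: mult_single flip: single_of_nat)
      then have "abs_yangian (Poly_Mapping.single 0 (1 / of_nat n)) * of_nat n = (1 :: ('a, 'b) yangian)"
        by (simp flip: of_nat add: times_yangian.abs_eq one_yangian.abs_eq)
      then have "x = abs_yangian (Poly_Mapping.single 0 (1 / of_nat n)) * (of_nat n * x)"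
        by (simp flip: mult.assoc)
      with * \<open>x \<noteq> 0\<close> show False by simp
    qed
  qed
qed

section \<open>The defining relations as relations between shifted series\<close>

lemma minus_one_power_mult:
  "(- 1) ^ n * x = signed (odd n) x" "x * (- 1) ^ n = signed (odd n) x" for x :: "'a::ring_1"
  by (cases "even n"; simp)+

lemma even_idx_par: "even (idx_par M i) \<longleftrightarrow> \<not> M < i"
  by (simp add: idx_par_def)

lemma double_subst_signed:
  "double_subst a b (\<lambda>r s. signed g (c r s)) = signed g (double_subst a b c)"
  by (cases g) (simp_all add: double_subst_uminus)

lemma T_series_nth: "fps_nth (T_series i j) r = T_coeff r i j"
  by (simp add: T_series_def)

lemma T_series_relation:
  fixes a b :: int
  defines "p \<equiv> \<lambda>i. LENGTH('m::len0) < i"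
  defines "t \<equiv> \<lambda>c i j. arg_shift c (T_series i j) :: ('m, 'n::len0) yangian fps"
  assumes I: "i \<in> {1..LENGTH('m) + LENGTH('n)}" "j \<in> {1..LENGTH('m) + LENGTH('n)}"
    "k \<in> {1..LENGTH('m) + LENGTH('n)}" "l \<in> {1..LENGTH('m) + LENGTH('n)}"
  shows "of_int (a - b) * (t a i j * t b k l - signed (p i \<noteq> p j \<and> p k \<noteq> p l) (t b k l * t a i j))
    = signed ((p i \<and> p k) \<noteq> ((p i \<and> p l) \<noteq> (p k \<and> p l))) (t a k j * t b i l - t b k j * t a i l)"
proof -
  let ?T = "T_coeff :: nat \<Rightarrow> nat \<Rightarrow> nat \<Rightarrow> ('m, 'n) yangian"
  let ?q = "p i \<noteq> p j \<and> p k \<noteq> p l" and ?g = "(p i \<and> p k) \<noteq> ((p i \<and> p l) \<noteq> (p k \<and> p l))"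
  have prod: "double_subst a b (\<lambda>r s. ?T r i' j' * ?T s k' l') = t a i' j' * t b k' l'"
    and prod': "double_subst a b (\<lambda>r s. ?T s k' l' * ?T r i' j') = t b k' l' * t a i' j'" for i' j' k' l'
    using double_subst_prod[of a b "T_series i' j'" "T_series k' l'"]
      double_subst_prod[of b a "T_series k' l'" "T_series i' j'"]
      double_subst_swap[of a b "\<lambda>s r. ?T s k' l' * ?T r i' j'"]
    by (simp_all add: T_series_nth t_def)
  let ?c = "\<lambda>r s. ?T r i j * ?T s k l - signed ?q (?T s k l * ?T r i j)"
  have rel: "?c (Suc r) s - ?c r (Suc s) = signed ?g (?T r k j * ?T s i l - ?T s k j * ?T r i l)" for r s
  proof -
    let ?p = "idx_par LENGTH('m)"
    have par: "odd ((?p i + ?p j) * (?p k + ?p l)) \<longleftrightarrow> ?q"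
      "odd (?p i * ?p k + ?p i * ?p l + ?p k * ?p l) \<longleftrightarrow> ?g"
      by (auto simp: even_idx_par p_def)
    have "signed ?g (?c (Suc r) s - ?c r (Suc s)) = ?T r k j * ?T s i l - ?T s k j * ?T r i l"
      using T_coeff_relation[OF I, of r s] by (simp only: minus_one_power_mult par)
    from this[symmetric] show ?thesis by simp
  qed
  \<comment> \<open>The boundary coefficients vanish: \<open>T_coeff 0 i j\<close> is 0 or 1, and it
    is 1 only for \<open>i = j\<close>, where \<open>?q\<close> gives an ordinary
    commutator.\<close>
  have "of_int (a - b) * double_subst a b ?c = double_subst a b (\<lambda>r s. ?c (Suc r) s - ?c r (Suc s))"
    by (rule double_subst_diff_mult) (auto simp: T_coeff_0)
  then show ?thesis
    by (simp only: rel double_subst_diff double_subst_signed prod prod')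
qed

lemma rtt_T_series:
  defines "p \<equiv> \<lambda>i. LENGTH('m::len0) < i"
  shows "rtt 1 p {1..LENGTH('m) + LENGTH('n)}
    (\<lambda>i j. signed (p j \<and> \<not> p i) (T_series i j :: ('m, 'n::len0) yangian fps))"
  unfolding rtt_def
proof (intro ballI allI)
  fix i j k l a b
  assume I: "i \<in> {1..LENGTH('m) + LENGTH('n)}" "j \<in> {1..LENGTH('m) + LENGTH('n)}"
    "k \<in> {1..LENGTH('m) + LENGTH('n)}" "l \<in> {1..LENGTH('m) + LENGTH('n)}"
  let ?t = "\<lambda>i j. signed (p j \<and> \<not> p i) (T_series i j :: ('m, 'n) yangian fps)"
  show "of_int (a - b) * (arg_shift a (?t i j) * arg_shift b (?t k l)
      - signed (p i \<noteq> p j \<and> p k \<noteq> p l) (arg_shift b (?t k l) * arg_shift a (?t i j)))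
    = of_int 1 * signed ((p i \<and> p j) \<noteq> ((p j \<and> p k) \<noteq> (p i \<and> p k)))
      (arg_shift a (?t k j) * arg_shift b (?t i l) - arg_shift b (?t k j) * arg_shift a (?t i l))"
    using T_series_relation[OF I, of a b, folded p_def]
    by (cases "p i"; cases "p j"; cases "p k"; cases "p l") (simp_all add: arg_shift_minus algebra_simps)
qed

section \<open>From the graded inverse to an ordinary inverse matrix\<close>

lemma fps_matrix_mult_eq_0:
  fixes t w :: "nat \<Rightarrow> nat \<Rightarrow> 'a::ring_1 fps"
  assumes fin: "finite I" and t0: "\<And>i j. fps_nth (t i j) 0 = (if i = j then 1 else 0)"
    and tw: "\<And>i. i \<in> I \<Longrightarrow> (\<Sum>k\<in>I. t i k * w k j) = 0" and i: "i \<in> I"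
  shows "w i j = 0"
proof (rule fps_ext)
  fix n
  show "fps_nth (w i j) n = fps_nth 0 n"
    using i
  proof (induction n arbitrary: i rule: less_induct)
    case (less n)
    have "(\<Sum>m=0..n. fps_nth (t i k) m * fps_nth (w k j) (n - m)) = fps_nth (t i k) 0 * fps_nth (w k j) n"
      if "k \<in> I" for k
    proof -
      have "(\<Sum>m=0..n. fps_nth (t i k) m * fps_nth (w k j) (n - m))
          = (\<Sum>m\<in>{0}. fps_nth (t i k) m * fps_nth (w k j) (n - m))"
        using less.IH that by (intro sum.mono_neutral_right) auto
      then show ?thesis by simp
    qed
    then have "fps_nth (\<Sum>k\<in>I. t i k * w k j) n = (\<Sum>k\<in>I. fps_nth (t i k) 0 * fps_nth (w k j) n)"
      by (simp add: fps_sum_nth fps_mult_nth)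
    also have "\<dots> = (\<Sum>k\<in>I. if i = k then fps_nth (w k j) n else 0)"
      by (intro sum.cong refl) (simp add: t0)
    also have "\<dots> = fps_nth (w i j) n"
      using less.prems fin by simp
    finally show ?case using tw[OF less.prems] by simp
  qed
qed

text \<open>Here t (y t - 1) = 0, and \<open>t\<close> can be cancelled because its leading matrix
  is the identity. The right inverse law is the convenient start: in
  \<open>super_mat_mult T_series T'\<close> the grading automorphism acts on generators of known
  degree, not on entries of \<open>T'\<close>.\<close>

lemma inverse_on_if_right_inverse:
  fixes t y :: "nat \<Rightarrow> nat \<Rightarrow> 'a::ring_1 fps"
  assumes fin: "finite I" and t0: "\<And>i j. fps_nth (t i j) 0 = (if i = j then 1 else 0)"
    and ty: "\<And>i j. i \<in> I \<Longrightarrow> j \<in> I \<Longrightarrow> (\<Sum>k\<in>I. t i k * y k j) = (if i = j then 1 else 0)"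
  shows "inverse_on I t y"
proof -
  have "(\<Sum>k\<in>I. y i k * t k j) - (if i = j then 1 else 0) = 0" if ij: "i \<in> I" "j \<in> I" for i j
  proof (rule fps_matrix_mult_eq_0[OF fin t0 _ ij(1), where j = j
        and w = "\<lambda>i j. (\<Sum>k\<in>I. y i k * t k j) - (if i = j then 1 else 0)"])
    fix i assume i: "i \<in> I"
    have "(\<Sum>k\<in>I. t i k * ((\<Sum>l\<in>I. y k l * t l j) - (if k = j then 1 else 0)))
        = (\<Sum>k\<in>I. \<Sum>l\<in>I. t i k * y k l * t l j) - (\<Sum>k\<in>I. if k = j then t i k else 0)"
      by (simp add: right_diff_distrib sum_subtractf sum_distrib_left mult.assoc if_distrib[of "\<lambda>x. _ * x"] cong: if_cong)
    also have "(\<Sum>k\<in>I. \<Sum>l\<in>I. t i k * y k l * t l j) = (\<Sum>l\<in>I. (\<Sum>k\<in>I. t i k * y k l) * t l j)"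
      by (subst sum.swap) (simp add: sum_distrib_right)
    also have "\<dots> = (\<Sum>l\<in>I. if i = l then t l j else 0)"
      using i by (intro sum.cong refl) (simp add: ty)
    finally show "(\<Sum>k\<in>I. t i k * ((\<Sum>l\<in>I. y k l * t l j) - (if k = j then 1 else 0))) = 0"
      using i ij fin by simp
  qed
  with fin ty show ?thesis by (simp add: inverse_on_def)
qed

lemma grading_aut_uminus: "grading_aut (- x) = - grading_aut x"
proof transfer
  fix x :: gen_algebra
  have "free_grading_aut LENGTH('a) (- x) = - free_grading_aut LENGTH('a) x"
    using free_grading_aut_diff[of "LENGTH('a)" 0 x] by (simp add: free_grading_aut_zero)
  then show "free_grading_aut LENGTH('a) (- x) - - free_grading_aut LENGTH('a) x
      \<in> yangian_ideal LENGTH('a) LENGTH('b)"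
    by (simp add: yangian_ideal.zero)
qed

lemma grading_aut_T_coeff:
  "grading_aut (T_coeff r i j :: ('m::len0, 'n::len0) yangian)
    = signed ((LENGTH('m) < i) \<noteq> (LENGTH('m) < j)) (T_coeff r i j)"
proof (cases "(LENGTH('m) < i) \<noteq> (LENGTH('m) < j)")
  case True
  then have "grading_aut (T_coeff r i j :: ('m, 'n) yangian) = - T_coeff r i j"
    by transfer (simp add: free_grading_aut_coeff minus_one_power_mult even_idx_par yangian_ideal.zero)
  with True show ?thesis by simp
next
  case False
  then have "grading_aut (T_coeff r i j :: ('m, 'n) yangian) = T_coeff r i j"
    by transfer (simp add: free_grading_aut_coeff minus_one_power_mult even_idx_par yangian_ideal.zero)
  with False show ?thesis by simp
qed

lemma grading_aut_funpow_T_coeff: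
  "(grading_aut ^^ n) (T_coeff r i j :: ('m::len0, 'n::len0) yangian)
    = signed (odd n \<and> (LENGTH('m) < i) \<noteq> (LENGTH('m) < j)) (T_coeff r i j)"
proof (induction n)
  case (Suc n)
  have "grading_aut (signed b x) = signed b (grading_aut x)" for b and x :: "('m, 'n) yangian"
    by (simp add: signed_def grading_aut_uminus)
  with Suc show ?case
    by (cases "even n"; cases "(LENGTH('m) < i) \<noteq> (LENGTH('m) < j)") (simp_all add: grading_aut_T_coeff grading_aut_uminus)
qed simp

text \<open>With all four indices equal, the right side of the relation is \<open>\<epsilon>\<close>
  times the same commutator, so \<open>a - b - \<epsilon>\<close> annihilates it. In the exceptional
  case \<open>a - b = \<epsilon>\<close> the roles of \<open>a\<close> and \<open>b\<close> are
  exchanged.\<close>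

lemma pivot_self_commute:
  fixes t :: "nat \<Rightarrow> nat \<Rightarrow> 'a::torsion_free_ring_1 fps"
  assumes rtt: "rtt \<epsilon> p I t" and "\<epsilon> \<noteq> 0" and x: "x \<in> I" "\<not> p x"
  shows "arg_shift a (t x x) * arg_shift b (t x x) = arg_shift b (t x x) * arg_shift a (t x x)"
proof -
  have *: "a - b = \<epsilon> \<or> arg_shift a (t x x) * arg_shift b (t x x) = arg_shift b (t x x) * arg_shift a (t x x)" for a b
  proof -
    let ?C = "arg_shift a (t x x) * arg_shift b (t x x) - arg_shift b (t x x) * arg_shift a (t x x)"
    have "of_int (a - b) * ?C = of_int \<epsilon> * ?C"
      using rtt x unfolding rtt_def by force
    then have "of_int (a - b - \<epsilon>) * ?C = 0"
      by (simp only: of_int_diff[of "a - b"] left_diff_distrib[of "of_int (a - b)"] diff_self)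
    then show ?thesis
      unfolding of_int_mult_eq_0_iff by auto
  qed
  from *[of a b] *[of b a] \<open>\<epsilon> \<noteq> 0\<close> show ?thesis by auto
qed

text \<open>The unit-difference relation also contains products with the arguments in the opposite
  order. The relations for columns (c, d) and (d, c) contain the same two of these with opposite
  signs, so adding them leaves the claim.\<close>

lemma antisym_columns_descending:
  fixes t :: "nat \<Rightarrow> nat \<Rightarrow> 'a::ring_1 fps"
  assumes rtt: "rtt 1 p I t" and J: "{m..<n} \<subseteq> I" "\<And>i. i \<in> {m..<n} \<Longrightarrow> \<not> p i"
  shows "antisym_columns m n (\<lambda>k c a. arg_shift (s - int k) (t a c))"
  unfolding antisym_columns_def
proof (intro allI impI)
  fix j c d a b assume "{j, Suc j, c, d, a, b} \<subseteq> {m..<n}"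
  then have cd: "c \<in> {m..<n}" "d \<in> {m..<n}" "a \<in> {m..<n}" "b \<in> {m..<n}" by auto
  have s: "s - int (Suc j) = s - int j - 1" by simp
  have rel: "arg_shift (s - int j) (t a c) * arg_shift (s - int j - 1) (t b d)
      - arg_shift (s - int j - 1) (t b d) * arg_shift (s - int j) (t a c)
    = arg_shift (s - int j) (t b c) * arg_shift (s - int j - 1) (t a d)
      - arg_shift (s - int j - 1) (t b c) * arg_shift (s - int j) (t a d)"
    if "a \<in> {m..<n}" "b \<in> {m..<n}" "c \<in> {m..<n}" "d \<in> {m..<n}" for a b c d
  proof -
    have "a \<in> I" "b \<in> I" "c \<in> I" "d \<in> I" using that J(1) by blast+
    with rtt_unit_difference[OF rtt, of a c b d "s - int j"] that show ?thesis by (simp add: J(2))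
  qed
  have *: "A - C = - (A' - C')" if "A - B = C - D" "A' - D = C' - B" for A A' B C C' D :: "'a fps"
  proof -
    have "A - C = B - D" "A' - C' = D - B" using that by (simp_all add: algebra_simps)
    then show ?thesis by simp
  qed
  from *[OF rel[of a b c d] rel[of a b d c]] cd
  show "arg_shift (s - int j) (t a c) * arg_shift (s - int (Suc j)) (t b d)
      - arg_shift (s - int j) (t b c) * arg_shift (s - int (Suc j)) (t a d)
    = - (arg_shift (s - int j) (t a d) * arg_shift (s - int (Suc j)) (t b c)
      - arg_shift (s - int j) (t b d) * arg_shift (s - int (Suc j)) (t a c))"
    unfolding s by blast
qed

text \<open>The mirror image, with the larger argument in the later factor. The labels are row
  indices of \<open>y\<close>, as in the second factor of the Berezinian.\<close>

lemma antisym_columns_ascending: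
  fixes y :: "nat \<Rightarrow> nat \<Rightarrow> 'a::ring_1 fps"
  assumes rtt: "rtt 1 p I y" and J: "{m..<n} \<subseteq> I" "\<And>i. i \<in> {m..<n} \<Longrightarrow> \<not> p i"
  shows "antisym_columns m n (\<lambda>k c a. arg_shift (int k - s) (y c a))"
  unfolding antisym_columns_def
proof (intro allI impI)
  fix j c d a b assume "{j, Suc j, c, d, a, b} \<subseteq> {m..<n}"
  then have cd: "c \<in> {m..<n}" "d \<in> {m..<n}" "a \<in> {m..<n}" "b \<in> {m..<n}" by auto
  define v where "v = int (Suc j) - s"
  have v: "int j - s = v - 1" by (simp add: v_def)
  have rel: "arg_shift v (y d b) * arg_shift (v - 1) (y c a)
      - arg_shift (v - 1) (y c a) * arg_shift v (y d b)
    = arg_shift v (y c b) * arg_shift (v - 1) (y d a)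
      - arg_shift (v - 1) (y c b) * arg_shift v (y d a)"
    if "a \<in> {m..<n}" "b \<in> {m..<n}" "c \<in> {m..<n}" "d \<in> {m..<n}" for a b c d
  proof -
    have "a \<in> I" "b \<in> I" "c \<in> I" "d \<in> I" using that J(1) by blast+
    with rtt_unit_difference[OF rtt, of d b c a v] that show ?thesis by (simp add: J(2))
  qed
  have *: "B - D = - (B' - D')" if "A - B = C - D" "C - B' = A - D'" for A B B' C D D' :: "'a fps"
  proof -
    have "B - D = A - C" "B' - D' = C - A" using that by (simp_all add: algebra_simps)
    then show ?thesis by simp
  qed
  from *[OF rel[of a b c d] rel[of a b d c]] cd
  show "arg_shift (int j - s) (y c a) * arg_shift (int (Suc j) - s) (y d b)
      - arg_shift (int j - s) (y c b) * arg_shift (int (Suc j) - s) (y d a)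
    = - (arg_shift (int j - s) (y d a) * arg_shift (int (Suc j) - s) (y c b)
      - arg_shift (int j - s) (y d b) * arg_shift (int (Suc j) - s) (y c a))"
    unfolding v v_def[symmetric] by blast
qed

subsection \<open>The quantum Berezinian\<close>

lemma schur_nth_0:
  assumes "\<And>i j. i \<in> I \<Longrightarrow> j \<in> I \<Longrightarrow> fps_nth (t i j) 0 = (if i = j then 1 else 0)"
    and "x \<in> I" "i \<in> I - {x}" "j \<in> I - {x}"
  shows "fps_nth (schur x e t i j) 0 = (if i = j then 1 else 0)"
  using assms by (simp add: schur_def)

lemma ndet_empty: "ndet m m F = 1"
  by (simp add: ndet_def)

section \<open>Renumbering and change of parity\<close>

lemma z_relation_reindex:
  assumes "z_relation p (f ` I) P t y Z" "inj_on f I"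
  shows "z_relation (\<lambda>i. p (f i)) I P (\<lambda>i j. t (f i) (f j)) (\<lambda>i j. y (f i) (f j)) Z"
  using assms unfolding z_relation_def by (auto simp: sum.reindex inj_on_eq_iff)

lemma rtt_reindex:
  "rtt \<epsilon> p (f ` I) t \<Longrightarrow> rtt \<epsilon> (\<lambda>i. p (f i)) I (\<lambda>i j. t (f i) (f j))"
  unfolding rtt_def by simp

lemma inverse_on_reindex:
  assumes "inverse_on (f ` I) t y" "inj_on f I"
  shows "inverse_on I (\<lambda>i j. t (f i) (f j)) (\<lambda>i j. y (f i) (f j))"
  using assms unfolding inverse_on_def by (auto simp: sum.reindex inj_on_eq_iff finite_image_iff)

lemma rtt_flip_parity: "rtt \<epsilon> (\<lambda>_. True) I t \<Longrightarrow> rtt (- \<epsilon>) (\<lambda>_. False) I t"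
  unfolding rtt_def by (simp add: right_diff_distrib)

lemma z_relation_flip_parity:
  assumes "z_relation (\<lambda>_. True) I P t y Z"
  shows "z_relation (\<lambda>_. False) I P t y Z"
proof -
  have "- S = (if i = j then signed True Z else 0) \<longleftrightarrow> S = (if i = j then Z else 0)" for S and i j :: nat
    by auto
  then show ?thesis
    using assms unfolding z_relation_def by (simp add: sum_negf)
qed

lemma rtt_cong_parity: "rtt \<epsilon> p I t \<Longrightarrow> (\<And>i. i \<in> I \<Longrightarrow> p i = q i) \<Longrightarrow> rtt \<epsilon> q I t"
  unfolding rtt_def by simp

lemma z_relation_cong_parity:
  "z_relation p I P t y Z \<Longrightarrow> (\<And>i. i \<in> I \<Longrightarrow> p i = q i) \<Longrightarrow> z_relation q I P t y Z"
  unfolding z_relation_def by (simp cong: sum.cong)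

lemma inverse_commute:
  assumes "d * e = 1" "e * d = 1" "d * z = z * d"
  shows "e * z = z * (e :: 'a::monoid_mult)"
proof -
  have "e * z = e * (z * d) * e"
    by (simp add: assms(1) mult.assoc)
  also have "\<dots> = e * d * (z * e)"
    by (simp only: assms(3)[symmetric] mult.assoc)
  finally show ?thesis by (simp add: assms(2))
qed

text \<open>The determinant gains the inverse pivot on its left when an index is added, so in
  \<open>Z * ?C m\<close> two inverse pivots stand to the right of \<open>Z'\<close>. They must be
  moved across \<open>Z'\<close> and past a pivot, which is why the commutation facts enter
  here.\<close>

lemma berezinian_odd_block:
  fixes t y :: "nat \<Rightarrow> nat \<Rightarrow> 'a::torsion_free_ring_1 fps"
  assumes "m \<le> n" "rtt (- 1) (\<lambda>_. False) {m..<n} t" "inverse_on {m..<n} t y"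
    "\<And>i j. i \<in> {m..<n} \<Longrightarrow> j \<in> {m..<n} \<Longrightarrow> fps_nth (t i j) 0 = (if i = j then 1 else 0)"
    "z_relation (\<lambda>_. False) {m..<n} (int m - int n) t y Z"
  shows "arg_shift 1 (ndet m n (\<lambda>k a. arg_shift (int k - int n) (y k a)))
    = Z * ndet m n (\<lambda>k a. arg_shift (int k - int n) (y k a))"
  using assms
proof (induction m arbitrary: t Z rule: inc_induct)
  case base
  then show ?case by (simp add: ndet_empty z_relation_def)
next
  case (step m)
  note rtt = step.prems(1) and inv = step.prems(2) and t0 = step.prems(3) and z = step.prems(4)
  let ?I = "{m..<n}" and ?P = "int m - int n"
  let ?C = "\<lambda>m. ndet m n (\<lambda>k a. arg_shift (int k - int n) (y k a))"
  have x: "m \<in> ?I" using step by simp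
  have I: "?I - {m} = {Suc m..<n}" by auto
  obtain e where e: "t m m * e = 1" "e * t m m = 1"
    using fps_unit_if_nth_0_eq_1[of "t m m"] t0[OF x x] by auto
  let ?d = "\<lambda>a. arg_shift a (t m m)" and ?e = "\<lambda>a. arg_shift a e" and ?s = "schur m e t"
  have de: "?d a * ?e a = 1" "?e a * ?d a = 1" for a
    using e by (simp_all flip: arg_shift_mult)
  define Z' where "Z' = ?e ?P * Z * ?d (?P + 1)"
  have z': "z_relation (\<lambda>_. False) {Suc m..<n} (int (Suc m) - int n) ?s y Z'"
  proof -
    have "z_relation (\<lambda>_. False) (?I - {m}) (?P - - 1) ?s y (?e ?P * Z * ?d (?P - - 1))"
    proof (rule z_relation_schur[OF rtt _ inv x _ e z])
      assume "?I = {m}"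
      then have "n - m = 1" by (metis card_atLeastLessThan card_1_singleton_iff One_nat_def)
      then show "?P = - 1" using step.hyps by simp
    qed simp_all
    moreover have "?P - - 1 = int (Suc m) - int n" "?P - - 1 = ?P + 1" by simp_all
    ultimately show ?thesis by (simp only: I Z'_def)
  qed
  have IH: "arg_shift 1 (?C (Suc m)) = Z' * ?C (Suc m)"
  proof (rule step.IH[OF _ _ _ z'])
    show "rtt (- 1) (\<lambda>_. False) {Suc m..<n} ?s"
      using rtt_schur[OF rtt inv x e] by (simp only: I)
    show "inverse_on {Suc m..<n} ?s y"
      using inverse_on_schur[OF inv x e] by (simp only: I)
    show "fps_nth (?s i j) 0 = (if i = j then 1 else 0)" if "i \<in> {Suc m..<n}" "j \<in> {Suc m..<n}" for i j
      using schur_nth_0[OF t0 x, of i j] that by auto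
  qed
  \<comment> \<open>The row of \<open>t\<close> is taken at u + m - n, the argument of the first
    factor of \<open>?C m\<close>; this is also the shift \<open>?P\<close>.\<close>
  have dC: "?d ?P * ?C m = ?C (Suc m)"
  proof (rule ndet_left_inverse[where W = "\<lambda>k c a. arg_shift (int k - int n) (y c a)"
        and x = "\<lambda>c. arg_shift ?P (t m c)"])
    have "rtt 1 (\<lambda>_. False) ?I y"
      using rtt_inverse[OF rtt inv] by simp
    then show "antisym_columns m n (\<lambda>k c a. arg_shift (int k - int n) (y c a))"
      by (rule antisym_columns_ascending) simp_all
    show "(\<Sum>c\<in>?I. arg_shift ?P (t m c) * arg_shift ?P (y c a)) = (if a = m then 1 else 0)"
      if "a \<in> ?I" for a
      using inverse_on_mult(1)[OF inverse_on_arg_shift[OF inv] x that, of ?P] by auto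
  qed (use step in simp)
  have dd: "?d a * ?d b = ?d b * ?d a" for a b
    by (rule pivot_self_commute[OF rtt _ x]) simp_all
  \<comment> \<open>\<open>Z'\<close> is a sum of products of a Schur complement entry and an
    inverse entry, both of which commute with the pivot; for the empty family it is 1.\<close>
  have dZ': "?d a * Z' = Z' * ?d a" for a
  proof (cases "{Suc m..<n} = {}")
    case True
    with z' have "Z' = 1" by (simp add: z_relation_def)
    then show ?thesis by simp
  next
    case False
    then obtain i where i: "i \<in> ?I - {m}" unfolding I by blast
    have "Z' = (\<Sum>k\<in>?I - {m}. arg_shift (int (Suc m) - int n) (?s k i) * y i k)"
      using z' i unfolding z_relation_def I by auto
    moreover have "?d a * (arg_shift (int (Suc m) - int n) (?s k i) * y i k)
        = arg_shift (int (Suc m) - int n) (?s k i) * y i k * ?d a" if "k \<in> ?I - {m}" for k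
      using pivot_commute_schur[OF rtt inv x _ e that i, of a "int (Suc m) - int n"]
        pivot_commute_inverse[OF rtt inv x _ i that, of a 0]
      by (simp flip: mult.assoc) (simp add: mult.assoc)
    ultimately show ?thesis
      by (simp only: sum_distrib_left sum_distrib_right cong: sum.cong)
  qed
  have eZ': "Z' * ?e a = ?e a * Z'" for a
    using inverse_commute[OF de dZ'] by simp
  have de': "?d a * ?e b = ?e b * ?d a" for a b
    using inverse_commute[OF de dd] by simp
  have C: "?C m = ?e ?P * ?C (Suc m)"
    unfolding dC[symmetric] by (simp add: de flip: mult.assoc)
  have Z: "Z = ?d ?P * Z' * ?e (?P + 1)"
    unfolding Z'_def by (simp add: de mult.assoc) (simp add: de flip: mult.assoc)
  have "Z * ?C m = ?d ?P * (Z' * ?e (?P + 1)) * (?e ?P * ?C (Suc m))"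
    by (subst Z, subst C) (simp only: mult.assoc)
  also have "\<dots> = (?d ?P * ?e (?P + 1)) * (Z' * ?e ?P) * ?C (Suc m)"
    by (simp only: eZ'[of "?P + 1"] mult.assoc)
  also have "\<dots> = ?e (?P + 1) * (?d ?P * ?e ?P) * (Z' * ?C (Suc m))"
    by (simp only: eZ'[of ?P] de'[of ?P "?P + 1"] mult.assoc)
  also have "\<dots> = arg_shift 1 (?e ?P * ?C (Suc m))"
    by (simp add: de arg_shift_mult IH add.commute)
  finally show ?case by (simp only: C[symmetric])
qed

text \<open>The odd factor \<open>C\<close> is a constant of the induction, since eliminating an
  even index keeps \<open>y\<close>. The shift \<open>M - N - m + 1\<close> is the number of even
  minus the number of odd indices that remain; it ends at \<open>- N\<close>.\<close>

lemma berezinian_blocks: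
  fixes t y :: "nat \<Rightarrow> nat \<Rightarrow> 'a::torsion_free_ring_1 fps"
  assumes C: "C = ndet 1 (N + 1) (\<lambda>k a. arg_shift (int k - 1 - int N) (y (M + k) (M + a)))"
    and "m \<le> M + 1" "rtt 1 (\<lambda>i. M < i) {m..<M + N + 1} t" "inverse_on {m..<M + N + 1} t y"
    "\<And>i j. i \<in> {m..<M + N + 1} \<Longrightarrow> j \<in> {m..<M + N + 1} \<Longrightarrow>
      fps_nth (t i j) 0 = (if i = j then 1 else 0)"
    "z_relation (\<lambda>i. M < i) {m..<M + N + 1} (int M - int N - int m + 1) t y Z"
  shows "arg_shift 1 (ndet m (M + 1) (\<lambda>k a. arg_shift (int M - int N - int k) (t a k)) * C)
    = Z * (ndet m (M + 1) (\<lambda>k a. arg_shift (int M - int N - int k) (t a k)) * C)"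
  using assms(2-)
proof (induction m arbitrary: t Z rule: inc_induct)
  case base
  let ?J = "{1..<N + 1}" and ?f = "\<lambda>i. M + i"
  have J: "{M + 1..<M + N + 1} = ?f ` ?J"
    by (simp add: image_add_atLeastLessThan add.commute)
  have inj: "inj_on ?f ?J" by simp
  have "rtt 1 (\<lambda>_. True) ?J (\<lambda>i j. t (?f i) (?f j))"
    using rtt_reindex[OF base(1)[unfolded J]] by (rule rtt_cong_parity) auto
  then have rtt: "rtt (- 1) (\<lambda>_. False) ?J (\<lambda>i j. t (?f i) (?f j))"
    by (rule rtt_flip_parity)
  have "z_relation (\<lambda>_. True) ?J (int M - int N - int (M + 1) + 1) (\<lambda>i j. t (?f i) (?f j)) (\<lambda>i j. y (?f i) (?f j)) Z"
    using z_relation_reindex[OF base(4)[unfolded J] inj] by (rule z_relation_cong_parity) auto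
  then have "z_relation (\<lambda>_. False) ?J (int M - int N - int (M + 1) + 1) (\<lambda>i j. t (?f i) (?f j)) (\<lambda>i j. y (?f i) (?f j)) Z"
    by (rule z_relation_flip_parity)
  moreover have "int M - int N - int (M + 1) + 1 = int 1 - int (N + 1)" by simp
  ultimately have z: "z_relation (\<lambda>_. False) ?J (int 1 - int (N + 1)) (\<lambda>i j. t (?f i) (?f j)) (\<lambda>i j. y (?f i) (?f j)) Z"
    by (simp only:)
  have "arg_shift 1 (ndet 1 (N + 1) (\<lambda>k a. arg_shift (int k - int (N + 1)) (y (?f k) (?f a))))
    = Z * ndet 1 (N + 1) (\<lambda>k a. arg_shift (int k - int (N + 1)) (y (?f k) (?f a)))"
    by (rule berezinian_odd_block[OF _ rtt inverse_on_reindex[OF base(2)[unfolded J] inj] _ z])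
      (use base(3) in auto)
  moreover have "int k - int (N + 1) = int k - 1 - int N" for k by simp
  ultimately show ?case
    by (simp only: ndet_empty C mult_1_left)
next
  case (step m)
  note rtt = step.prems(1) and inv = step.prems(2) and t0 = step.prems(3) and z = step.prems(4)
  let ?I = "{m..<M + N + 1}" and ?P = "int M - int N - int m + 1" and ?p = "\<lambda>i. M < i"
  let ?A = "\<lambda>m t. ndet m (M + 1) (\<lambda>k a. arg_shift (int M - int N - int k) (t a k))"
  have x: "m \<in> ?I" and px: "\<not> M < m" using step by simp_all
  have I: "?I - {m} = {Suc m..<M + N + 1}" by auto
  obtain e where e: "t m m * e = 1" "e * t m m = 1"
    using fps_unit_if_nth_0_eq_1[of "t m m"] t0[OF x x] by auto
  let ?d = "\<lambda>a. arg_shift a (t m m)" and ?s = "schur m e t"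
  have de: "?d ?P * arg_shift ?P e = 1"
    by (simp add: e flip: arg_shift_mult)
  define Z' where "Z' = arg_shift ?P e * Z * ?d (?P - 1)"
  have z': "z_relation ?p {Suc m..<M + N + 1} (int M - int N - int (Suc m) + 1) ?s y Z'"
  proof -
    have "z_relation ?p (?I - {m}) (?P - 1) ?s y Z'"
      unfolding Z'_def
    proof (rule z_relation_schur[OF rtt _ inv x px e z])
      assume "?I = {m}"
      then have "M + N + 1 - m = 1" by (metis card_atLeastLessThan card_1_singleton_iff One_nat_def)
      then show "?P = 1" using px by simp
    qed simp_all
    moreover have "?P - 1 = int M - int N - int (Suc m) + 1" by simp
    ultimately show ?thesis by (simp only: I)
  qed
  have IH: "arg_shift 1 (?A (Suc m) ?s * C) = Z' * (?A (Suc m) ?s * C)"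
  proof (rule step.IH[OF _ _ _ z'])
    show "rtt 1 ?p {Suc m..<M + N + 1} ?s"
      using rtt_schur[OF rtt inv x e] by (simp only: I)
    show "inverse_on {Suc m..<M + N + 1} ?s y"
      using inverse_on_schur[OF inv x e] by (simp only: I)
    show "fps_nth (?s i j) 0 = (if i = j then 1 else 0)"
      if "i \<in> {Suc m..<M + N + 1}" "j \<in> {Suc m..<M + N + 1}" for i j
      using schur_nth_0[OF t0 x, of i j] that by auto
  qed
  have A: "?A m t = ?d (?P - 1) * ?A (Suc m) ?s"
  proof -
    have "?A m t = ?d (int M - int N - int m) * ?A (Suc m) ?s"
    proof (rule ndet_schur[where W = "\<lambda>k c a. arg_shift (int M - int N - int k) (t a c)"
          and z = "\<lambda>k. arg_shift (int M - int N - int k) (e * t m k)"])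
      show "antisym_columns m (M + 1) (\<lambda>k c a. arg_shift (int M - int N - int k) (t a c))"
        by (rule antisym_columns_descending[OF rtt]) auto
      show "m < M + 1" using step.hyps by simp
      show "arg_shift (int M - int N - int k) (?s a k)
          = arg_shift (int M - int N - int k) (t a k)
            - arg_shift (int M - int N - int k) (t a m) * arg_shift (int M - int N - int k) (e * t m k)" for k a
        by (simp add: schur_def arg_shift_diff arg_shift_mult mult.assoc)
      have "?s m k = 0" for k
        by (simp add: schur_def e)
      then show "arg_shift (int M - int N - int k) (?s m k) = 0" for k by simp
    qed
    moreover have "?P - 1 = int M - int N - int m" by simp
    ultimately show ?thesis by (simp only:)
  qed
  \<comment> \<open>The shift by 1 brings the pivot to \<open>?P\<close>, where it cancels the
    inverse pivot in \<open>Z'\<close>; the right pivot of \<open>Z'\<close>, at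
    \<open>?P - 1\<close>, restores the larger determinant.\<close>
  have "arg_shift 1 (?A m t * C) = arg_shift 1 (?d (?P - 1)) * arg_shift 1 (?A (Suc m) ?s * C)"
    unfolding A by (simp only: arg_shift_mult mult.assoc)
  also have "\<dots> = ?d ?P * (Z' * (?A (Suc m) ?s * C))"
    by (simp only: IH) (simp add: add.commute)
  also have "\<dots> = (?d ?P * arg_shift ?P e) * Z * (?d (?P - 1) * ?A (Suc m) ?s * C)"
    by (simp only: Z'_def mult.assoc)
  finally show ?case
    unfolding A[symmetric] de mult_1_left .
qed

theorem theorem3p1:
  fixes T' :: "nat \<Rightarrow> nat \<Rightarrow> ('m::len0, 'n::len0) yangian fps"
    and Z :: "('m, 'n) yangian fps"
  assumes "LENGTH('m) + LENGTH('n) \<noteq> 0"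
    and "super_mat_inverse T_series T'"
    and "\<forall>i \<in> {1..LENGTH('m) + LENGTH('n)}. \<forall>j \<in> {1..LENGTH('m) + LENGTH('n)}.
      (\<Sum>k = 1..LENGTH('m) + LENGTH('n).
        arg_shift (int LENGTH('m) - int LENGTH('n)) (T_series k j) * T' i k) = (if i = j then Z else 0)"
  shows "arg_shift 1 (berezinian T') = Z * berezinian T'"
proof -
  define M N where "M = LENGTH('m)" and "N = LENGTH('n)"
  let ?p = "\<lambda>i. M < i" and ?I = "{1..M + N}"
  define t where "t i j = signed (?p j \<and> \<not> ?p i) (T_series i j :: ('m, 'n) yangian fps)" for i j
  define y where "y i j = signed (?p j \<and> \<not> ?p i) (T' i j)" for i j
  have I: "?I = {1..<M + N + 1}" by auto
  have rtt: "rtt 1 ?p ?I t"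
    using rtt_T_series[where 'm = 'm and 'n = 'n] by (simp add: t_def[abs_def] M_def N_def)
  have t0: "fps_nth (t i j) 0 = (if i = j then 1 else 0)" for i j
    by (simp add: t_def fps_nth_signed T_series_nth T_coeff_0)
  have inv: "inverse_on ?I t y"
  proof (rule inverse_on_if_right_inverse[OF _ t0])
    fix i l assume il: "i \<in> ?I" "l \<in> ?I"
    \<comment> \<open>The sign of the graded product and the signs in \<open>t\<close> and
      \<open>y\<close> combine to one that is independent of the summation index
      \<open>j\<close>.\<close>
    have entry: "Abs_fps (\<lambda>r. (grading_aut ^^ (idx_par M j + idx_par M l)) (fps_nth (T_series i j :: ('m, 'n) yangian fps) r)) * T' j l
        = signed (?p l \<and> \<not> ?p i) (t i j * y j l)" for j
    proof -
      have "Abs_fps (\<lambda>r. (grading_aut ^^ (idx_par M j + idx_par M l)) (fps_nth (T_series i j :: ('m, 'n) yangian fps) r))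
          = signed ((?p j \<noteq> ?p l) \<and> (?p i \<noteq> ?p j)) (T_series i j)"
        by (rule fps_ext)
          (simp add: T_series_nth fps_nth_signed grading_aut_funpow_T_coeff even_idx_par M_def)
      then show ?thesis
        by (cases "?p i"; cases "?p j"; cases "?p l") (simp_all add: t_def y_def)
    qed
    have "super_mat_mult T_series T' i l = (if i = l then 1 else 0)"
      using assms(2) il by (simp add: super_mat_inverse_def M_def N_def)
    then have "signed (?p l \<and> \<not> ?p i) (\<Sum>j\<in>?I. t i j * y j l) = (if i = l then 1 else 0)"
      by (simp add: super_mat_mult_def entry signed_sum flip: M_def N_def)
    then show "(\<Sum>j\<in>?I. t i j * y j l) = (if i = l then 1 else 0)"
      by (cases "?p l \<and> \<not> ?p i") (auto simp: minus_equation_iff split: if_splits)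
  qed simp
  have z: "z_relation ?p ?I (int M - int N) t y Z"
    unfolding z_relation_def
  proof (intro conjI impI ballI)
    assume "?I = {}"
    with assms(1) show "Z = 1" by (auto simp: M_def N_def)
  next
    fix i j assume ij: "i \<in> ?I" "j \<in> ?I"
    have "(\<Sum>k\<in>?I. signed (?p k \<and> ?p i = ?p j) (arg_shift (int M - int N) (t k j) * y i k))
        = (\<Sum>k\<in>?I. signed (?p j) (arg_shift (int M - int N) (T_series k j) * T' i k))"
    proof (intro sum.cong refl)
      fix k
      show "signed (?p k \<and> ?p i = ?p j) (arg_shift (int M - int N) (t k j) * y i k)
          = signed (?p j) (arg_shift (int M - int N) (T_series k j) * T' i k)"
        by (cases "?p i"; cases "?p j"; cases "?p k") (simp_all add: t_def y_def arg_shift_minus)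
    qed
    also have "\<dots> = signed (?p j) (\<Sum>k\<in>?I. arg_shift (int M - int N) (T_series k j) * T' i k)"
      by (simp only: signed_sum)
    also have "(\<Sum>k\<in>?I. arg_shift (int M - int N) (T_series k j) * T' i k) = (if i = j then Z else 0)"
      using assms(3) ij by (simp add: M_def N_def)
    finally show "(\<Sum>k\<in>?I. signed (?p k \<and> ?p i = ?p j) (arg_shift (int M - int N) (t k j) * y i k))
        = (if i = j then signed (?p j) Z else 0)"
      by simp
  qed
  have "(\<Sum>\<sigma> | \<sigma> permutes {1..M}. of_int (sign \<sigma>) * (\<Prod>k\<leftarrow>[1..<M + 1].
        arg_shift (int M - int N - int k) (T_series (\<sigma> k) k :: ('m, 'n) yangian fps)))
      = ndet 1 (M + 1) (\<lambda>k a. arg_shift (int M - int N - int k) (T_series a k))"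
    by (simp add: ndet_def atLeastLessThanSuc_atLeastAtMost)
  \<comment> \<open>Both indices of an entry have equal parity here, so the sign in \<open>t\<close>
    is trivial; likewise for \<open>y\<close> in the odd block.\<close>
  also have "\<dots> = ndet 1 (M + 1) (\<lambda>k a. arg_shift (int M - int N - int k) (t a k))"
    by (rule ndet_cong) (simp add: t_def)
  finally have even: "(\<Sum>\<sigma> | \<sigma> permutes {1..M}. of_int (sign \<sigma>) * (\<Prod>k\<leftarrow>[1..<M + 1].
        arg_shift (int M - int N - int k) (T_series (\<sigma> k) k :: ('m, 'n) yangian fps)))
      = ndet 1 (M + 1) (\<lambda>k a. arg_shift (int M - int N - int k) (t a k))" .
  have "(\<Sum>\<sigma> | \<sigma> permutes {1..N}. of_int (sign \<sigma>) * (\<Prod>k\<leftarrow>[1..<N + 1].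
        arg_shift (int k - 1 - int N) (T' (M + k) (M + \<sigma> k))))
      = ndet 1 (N + 1) (\<lambda>k a. arg_shift (int k - 1 - int N) (T' (M + k) (M + a)))"
    by (simp add: ndet_def atLeastLessThanSuc_atLeastAtMost)
  also have "\<dots> = ndet 1 (N + 1) (\<lambda>k a. arg_shift (int k - 1 - int N) (y (M + k) (M + a)))"
    by (rule ndet_cong) (simp add: y_def)
  finally have "berezinian T' = ndet 1 (M + 1) (\<lambda>k a. arg_shift (int M - int N - int k) (t a k))
      * ndet 1 (N + 1) (\<lambda>k a. arg_shift (int k - 1 - int N) (y (M + k) (M + a)))"
    using even by (simp only: berezinian_def Let_def flip: M_def N_def)
  moreover have "arg_shift 1 (ndet 1 (M + 1) (\<lambda>k a. arg_shift (int M - int N - int k) (t a k))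
      * ndet 1 (N + 1) (\<lambda>k a. arg_shift (int k - 1 - int N) (y (M + k) (M + a))))
    = Z * (ndet 1 (M + 1) (\<lambda>k a. arg_shift (int M - int N - int k) (t a k))
      * ndet 1 (N + 1) (\<lambda>k a. arg_shift (int k - 1 - int N) (y (M + k) (M + a))))"
  proof (rule berezinian_blocks[OF refl _ rtt[unfolded I] inv[unfolded I]])
    show "z_relation ?p {1..<M + N + 1} (int M - int N - int 1 + 1) t y Z"
      using z unfolding I by simp
  qed (simp_all add: t0)
  ultimately show ?thesis by (simp only:)
qed

end
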